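(* Let $n=2p+1$ with $p\ge1$, and let all masses be $m_1=\dots=m_n=1$. Let $\bar{\mathbf q}$ be the regular $n$-gon equilibrium configuration on $\mathbb{S}^1$, with angles $\varphi_j=\frac{2\pi j}{n}$, $j=1,\dots,n$. For $\alpha\in\mathbb{R}$ let $X_\alpha$ be the equilibrium of the reduced Hamiltonian system $(H_1,\,J_1^{-1}(n\alpha)/SO(2),\,\omega_1)$ corresponding to the relative equilibrium in which $\bar{\mathbf q}$ rotates with angular velocity $\alpha$ along $\mathbb{S}^1$; in the coordinates $(u_2,\dots,u_n,v_2,\dots,v_n)$, $$X_\alpha=\Big(\tfrac{2}{n}\pi,\tfrac{3}{n}\pi,\dots,\tfrac{n}{n}\pi,\,0,\dots,0\Big).$$ Then $X_\alpha$ is Lyapunov stable for the reduced Hamiltonian system $(H_1,\,J_1^{-1}(n\alpha)/SO(2),\,\omega_1)$ for all $\alpha\in\mathbb{R}$.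
   Context: The $n$-body problem on the great circle $\mathbb{S}^1$ (the unit circle) with masses $1$: the positions are angles $\varphi_1,\dots,\varphi_n$ with conjugate momenta $p_{\varphi_1},\dots,p_{\varphi_n}$. The distance $d_{ij}\in(0,\pi)$ is given by $\cos d_{ij}=\cos(\varphi_i-\varphi_j)$ (configurations with $\varphi_i-\varphi_j\in\pi\mathbb{Z}$ for some $i\neq j$ are excluded), the potential is $U=\sum_{1\le i<j\le n}\cot d_{ij}$, and the Hamiltonian is $H=\sum_{i=1}^n\frac12p_{\varphi_i}^2-U$. The group $SO(2)$ acts by $\varphi_i\mapsto\varphi_i+s$ (all $i$), with first integral $J_1=\sum_{i=1}^np_{\varphi_i}$. Reduction: use the Jacobi coordinates $$u_k=\varphi_k-\frac1{k-1}\sum_{i=1}^{k-1}\varphi_i\quad(k=2,\dots,n),\qquad g_n=\frac1n\sum_{i=1}^n\varphi_i ,$$ i.e. $(u_2,\dots,u_n,g_n)=\mathcal A(\varphi_1,\dots,\varphi_n)$ with $\mathcal A$ an invertible constant matrix, and conjugate momenta $(v_2,\dots,v_n,G_n)$ defined by $(p_{\varphi_1},\dots,p_{\varphi_n})=\mathcal A^T(v_2,\dots,v_n,G_n)$, so that $G_n=J_1$. The potential $U$ does not depend on $g_n$, so (locally) $U=U(u_2,\dots,u_n)$. The reduced space $J_1^{-1}(c)/SO(2)$ has canonical (local) coordinates $(u_2,\dots,u_n,v_2,\dots,v_n)$, with $\omega_1=d(\sum_{i=2}^nu_i\,dv_i)=\sum_{i=2}^n du_i\wedge dv_i$, and the reduced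 Hamiltonian (up to the constant $c^2/(2n)$) is $$H_1=\sum_{i=2}^n\frac{v_i^2}{2\mathtt M_i}-U(u_2,\dots,u_n),\qquad \mathtt M_i=\frac{i-1}{i}.$$ The equations of motion are $\dot u_i=\partial H_1/\partial v_i$, $\dot v_i=-\partial H_1/\partial u_i$. Lyapunov stability is in the usual sense for an equilibrium of this system. *)

theory Defs
  imports "HOL-Analysis.Analysis"
begin

section \<open>Hamiltonian systems and Lyapunov stability\<close>

text \<open>
  A point of phase space is a pair (positions, momenta) of real families. A degree of freedom is
  an index in a finite set I; values at indices outside I are irrelevant junk.
  D is the domain (open set of admissible states) of the Hamiltonian.
\<close>

type_synonym coords = "nat \<Rightarrow> real"
type_synonym state = "coords \<times> coords"

definition partial_pos :: "(state \<Rightarrow> real) \<Rightarrow> nat \<Rightarrow> state \<Rightarrow> real" where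
  "partial_pos H i x = deriv (\<lambda>s. H ((fst x)(i := s), snd x)) (fst x i)"

definition partial_mom :: "(state \<Rightarrow> real) \<Rightarrow> nat \<Rightarrow> state \<Rightarrow> real" where
  "partial_mom H i x = deriv (\<lambda>s. H (fst x, (snd x)(i := s))) (snd x i)"

definition hamiltonian_solution ::
  "nat set \<Rightarrow> state set \<Rightarrow> (state \<Rightarrow> real) \<Rightarrow> real set \<Rightarrow> (real \<Rightarrow> state) \<Rightarrow> bool" where
  "hamiltonian_solution I D H J z \<longleftrightarrow>
     (\<forall>t\<in>J. z t \<in> D \<and>
       (\<forall>i\<in>I. ((\<lambda>s. fst (z s) i) has_real_derivative partial_mom H i (z t)) (at t within J) \<and>
              ((\<lambda>s. snd (z s) i) has_real_derivative - partial_pos H i (z t)) (at t within J)))"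

definition state_dist :: "nat set \<Rightarrow> state \<Rightarrow> state \<Rightarrow> real" where
  "state_dist I x y = sqrt (\<Sum>i\<in>I. (fst x i - fst y i)\<^sup>2 + (snd x i - snd y i)\<^sup>2)"

definition hamiltonian_equilibrium ::
  "nat set \<Rightarrow> state set \<Rightarrow> (state \<Rightarrow> real) \<Rightarrow> state \<Rightarrow> bool" where
  "hamiltonian_equilibrium I D H x \<longleftrightarrow> hamiltonian_solution I D H UNIV (\<lambda>_. x)"

text \<open>
  Lyapunov stability (forward in time). Nearby initial states are required to have a solution for
  all times \<^term>\<open>t \<ge> 0\<close>, and every solution from such a state, on whatever interval
  \<^term>\<open>{0..<T}\<close> it is defined, has to stay near the equilibrium. Without the first part a system
  whose nearby solutions cease to exist would count as stable.
\<close>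

definition lyapunov_stable ::
  "nat set \<Rightarrow> state set \<Rightarrow> (state \<Rightarrow> real) \<Rightarrow> state \<Rightarrow> bool" where
  "lyapunov_stable I D H x \<longleftrightarrow>
     hamiltonian_equilibrium I D H x \<and>
     (\<forall>\<epsilon>>0. \<exists>\<delta>>0. \<forall>y\<in>D. state_dist I y x < \<delta> \<longrightarrow>
        (\<exists>z. hamiltonian_solution I D H {0..} z \<and> z 0 = y) \<and>
        (\<forall>T z. hamiltonian_solution I D H {0..<T} z \<and> z 0 = y \<longrightarrow>
             (\<forall>t\<in>{0..<T}. state_dist I (z t) x < \<epsilon>)))"


section \<open>The equal-mass n-body problem on the circle\<close>

text \<open>
  Angles are real numbers (lifted from the circle); the collision condition and the potential
  are invariant under shifting a single angle by \<^term>\<open>2 * pi\<close>.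
\<close>

definition collision_free :: "nat \<Rightarrow> coords \<Rightarrow> bool" where
  "collision_free n \<phi> \<longleftrightarrow>
     (\<forall>i\<in>{1..n}. \<forall>j\<in>{1..n}. i \<noteq> j \<longrightarrow> \<phi> i - \<phi> j \<notin> range (\<lambda>m::int. of_int m * pi))"

definition circle_dist :: "real \<Rightarrow> real \<Rightarrow> real" where
  "circle_dist a b = arccos (cos (a - b))"

definition potential :: "nat \<Rightarrow> coords \<Rightarrow> real" where
  "potential n \<phi> = (\<Sum>i=1..n. \<Sum>j=i+1..n. cot (circle_dist (\<phi> i) (\<phi> j)))"

definition nbody_phase_space :: "nat \<Rightarrow> state set" where
  "nbody_phase_space n = {(\<phi>, P). collision_free n \<phi>}"

definition nbody_hamiltonian :: "nat \<Rightarrow> state \<Rightarrow> real" where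
  "nbody_hamiltonian n = (\<lambda>(\<phi>, P). (\<Sum>i=1..n. (P i)\<^sup>2 / 2) - potential n \<phi>)"

definition J1 :: "nat \<Rightarrow> state \<Rightarrow> real" where
  "J1 n = (\<lambda>(\<phi>, P). \<Sum>i=1..n. P i)"


section \<open>Reduction in Jacobi coordinates\<close>

definition jacobi_u :: "coords \<Rightarrow> nat \<Rightarrow> real" where
  "jacobi_u \<phi> k = \<phi> k - (\<Sum>i=1..k-1. \<phi> i) / (real k - 1)"

definition jacobi_g :: "nat \<Rightarrow> coords \<Rightarrow> real" where
  "jacobi_g n \<phi> = (\<Sum>i=1..n. \<phi> i) / real n"

definition unit_coords :: "nat \<Rightarrow> coords" where
  "unit_coords j = (\<lambda>i. if i = j then 1 else 0)"

text \<open>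
  The momenta \<open>p\<^sub>1, \<dots>, p\<^sub>n\<close> as the transpose of the Jacobi matrix applied to
  \<open>(v\<^sub>2, \<dots>, v\<^sub>n, G)\<close>: the j-th column of that matrix is the image of the j-th unit vector.
\<close>

definition momenta_of :: "nat \<Rightarrow> coords \<Rightarrow> real \<Rightarrow> coords" where
  "momenta_of n v G j =
     (\<Sum>k=2..n. v k * jacobi_u (unit_coords j) k) + G * jacobi_g n (unit_coords j)"

text \<open>The angles with given \<open>u\<^sub>2, \<dots>, u\<^sub>n\<close> and \<open>g\<^sub>n = 0\<close>; see the two inversion lemmas.\<close>

definition angles_of :: "nat \<Rightarrow> coords \<Rightarrow> coords" where
  "angles_of n u j = (if 2 \<le> j then u j else 0) - (\<Sum>i=max 2 j..n. u i / real i)"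

definition reduced_potential :: "nat \<Rightarrow> coords \<Rightarrow> real" where
  "reduced_potential n u = potential n (angles_of n u)"

definition reduced_phase_space :: "nat \<Rightarrow> state set" where
  "reduced_phase_space n = {(u, v). collision_free n (angles_of n u)}"

definition jacobi_mass :: "nat \<Rightarrow> real" where
  "jacobi_mass i = (real i - 1) / real i"

definition reduced_hamiltonian :: "nat \<Rightarrow> state \<Rightarrow> real" where
  "reduced_hamiltonian n =
     (\<lambda>(u, v). (\<Sum>i=2..n. (v i)\<^sup>2 / (2 * jacobi_mass i)) - reduced_potential n u)"

text \<open>
  \<open>reduces_to n c (\<phi>, P) (u, v)\<close>: the state \<open>(\<phi>, P)\<close> lies on the level set \<open>J1 = c\<close>, and its
  rotation orbit is the point of the reduced space with coordinates \<open>(u, v)\<close>.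
\<close>

definition reduces_to :: "nat \<Rightarrow> real \<Rightarrow> state \<Rightarrow> state \<Rightarrow> bool" where
  "reduces_to n c x y \<longleftrightarrow>
     J1 n x = c \<and>
     (\<forall>k\<in>{2..n}. fst y k = jacobi_u (fst x) k) \<and>
     (\<forall>j\<in>{1..n}. snd x j = momenta_of n (snd y) c j)"

definition rotating_polygon :: "nat \<Rightarrow> real \<Rightarrow> real \<Rightarrow> state" where
  "rotating_polygon n \<alpha> t = ((\<lambda>j. 2 * pi * real j / real n + \<alpha> * t), (\<lambda>_. \<alpha>))"

definition polygon_equilibrium :: "nat \<Rightarrow> state" where
  "polygon_equilibrium n = ((\<lambda>k. real k / real n * pi), (\<lambda>_. 0))"


subsection \<open>The reduction is the one described by the Jacobi coordinates\<close>

lemma jacobi_g_step: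
  assumes "m \<ge> 1"
  shows "jacobi_g (Suc m) \<phi> = jacobi_g m \<phi> + jacobi_u \<phi> (Suc m) / real (Suc m)"
proof -
  have *: "(S + f) / (1 + M) = S / M + (f - S / M) / (1 + M)" if "M > 0" for S f M :: real
    using that by (simp add: divide_simps) (simp add: algebra_simps)
  show ?thesis
    using *[of "real m" "\<Sum>i=1..m. \<phi> i" "\<phi> (Suc m)"] assms
    by (simp add: jacobi_g_def jacobi_u_def)
qed

lemma jacobi_g_telescope:
  assumes "1 \<le> a" "a \<le> m"
  shows "jacobi_g m \<phi> = jacobi_g a \<phi> + (\<Sum>i=Suc a..m. jacobi_u \<phi> i / real i)"
  using assms(2,1)
proof (induction m rule: dec_induct)
  case base
  then show ?case by simp
next
  case (step m)
  then show ?case by (simp add: jacobi_g_step)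
qed

lemma angles_of_jacobi_u:
  assumes "j \<in> {1..n}"
  shows "angles_of n (jacobi_u \<phi>) j = \<phi> j - jacobi_g n \<phi>"
proof (cases "j = 1")
  case True
  then show ?thesis
    using jacobi_g_telescope[of 1 n \<phi>] assms
    by (simp add: angles_of_def jacobi_g_def numeral_2_eq_2)
next
  case False
  then have j: "2 \<le> j" "j \<le> n" using assms by auto
  have "jacobi_g n \<phi> = jacobi_g (j - 1) \<phi> + (\<Sum>i=j..n. jacobi_u \<phi> i / real i)"
    using jacobi_g_telescope[of "j - 1" n \<phi>] j by simp
  moreover have "\<phi> j = jacobi_u \<phi> j + jacobi_g (j - 1) \<phi>"
    using j by (simp add: jacobi_u_def jacobi_g_def of_nat_diff)
  ultimately show ?thesis using j by (simp add: angles_of_def)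
qed

lemma jacobi_g_angles_of_aux:
  assumes "1 \<le> m" "m \<le> n"
  shows "jacobi_g m (angles_of n u) = - (\<Sum>i=Suc m..n. u i / real i)"
  using assms
proof (induction m rule: dec_induct)
  case base
  then show ?case by (simp add: jacobi_g_def angles_of_def numeral_2_eq_2)
next
  case (step m)
  let ?S = "\<Sum>i=Suc (Suc m)..n. u i / real i"
  have S: "(\<Sum>i=Suc m..n. u i / real i) = u (Suc m) / real (Suc m) + ?S"
    using step by (simp add: sum.atLeast_Suc_atMost)
  have a: "angles_of n u (Suc m) = u (Suc m) - u (Suc m) / real (Suc m) - ?S"
    using step S by (simp add: angles_of_def)
  have IH: "(\<Sum>i=1..m. angles_of n u i) = - real m * (u (Suc m) / real (Suc m) + ?S)"
  proof -
    have "(\<Sum>i=1..m. angles_of n u i) = real m * jacobi_g m (angles_of n u)"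
      using step.hyps by (simp add: jacobi_g_def)
    moreover have "jacobi_g m (angles_of n u) = - (u (Suc m) / real (Suc m) + ?S)"
      using step S by simp
    ultimately show ?thesis by (simp add: algebra_simps)
  qed
  have "- M * (x / (1 + M) + S) + (x - x / (1 + M) - S) = - (1 + M) * S" if "M > 0" for M x S :: real
  proof -
    have "M * (x / (1 + M)) + x / (1 + M) = x"
      using that by (simp add: divide_simps) (simp add: algebra_simps)
    then show ?thesis by (simp add: algebra_simps)
  qed
  from this[of "real m" "u (Suc m)" ?S]
  have "(\<Sum>i=1..Suc m. angles_of n u i) = - real (Suc m) * ?S"
    using IH a step by simp
  then show ?case
    unfolding jacobi_g_def by (simp only:) (simp del: of_nat_Suc)
qed

lemma jacobi_g_angles_of: "n \<ge> 1 \<Longrightarrow> jacobi_g n (angles_of n u) = 0"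
  using jacobi_g_angles_of_aux[of n n u] by simp

lemma jacobi_u_angles_of:
  assumes "k \<in> {2..n}"
  shows "jacobi_u (angles_of n u) k = u k"
proof -
  have "jacobi_g (k - 1) (angles_of n u) = - (\<Sum>i=k..n. u i / real i)"
    using jacobi_g_angles_of_aux[of "k - 1" n u] assms by auto
  moreover have "jacobi_u (angles_of n u) k = angles_of n u k - jacobi_g (k - 1) (angles_of n u)"
    using assms by (simp add: jacobi_u_def jacobi_g_def of_nat_diff)
  ultimately show ?thesis using assms by (simp add: angles_of_def)
qed

lemma circle_dist_collision_free:
  assumes "collision_free n \<phi>" "i \<in> {1..n}" "j \<in> {1..n}" "i \<noteq> j"
  shows "circle_dist (\<phi> i) (\<phi> j) \<in> {0<..<pi}"
    and "cos (circle_dist (\<phi> i) (\<phi> j)) = cos (\<phi> i - \<phi> j)"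
proof -
  let ?x = "\<phi> i - \<phi> j"
  have "sin ?x \<noteq> 0"
    using assms unfolding collision_free_def sin_zero_iff_int2 by blast
  then have "(cos ?x)\<^sup>2 < 1"
    by (metis cos_squared_eq diff_less_eq less_add_same_cancel1 zero_less_power2)
  then have "-1 < cos ?x" "cos ?x < 1"
    by (auto simp: abs_square_less_1 abs_less_iff)
  then show "circle_dist (\<phi> i) (\<phi> j) \<in> {0<..<pi}"
    using arccos_lt_bounded[of "cos ?x"] by (simp add: circle_dist_def)
  show "cos (circle_dist (\<phi> i) (\<phi> j)) = cos ?x"
    by (simp add: circle_dist_def cos_arccos)
qed

lemma potential_cong:
  assumes "\<And>j. j \<in> {1..n} \<Longrightarrow> \<phi> j = \<psi> j + s"
  shows "potential n \<phi> = potential n \<psi>"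
  unfolding potential_def
  by (intro sum.cong refl) (simp add: circle_dist_def assms)

lemma jacobi_u_unit:
  assumes "2 \<le> k" "1 \<le> j"
  shows "jacobi_u (unit_coords j) k =
    (if j = k then 1 else if j < k then - 1 / (real k - 1) else 0)"
  using assms by (auto simp: jacobi_u_def unit_coords_def sum.delta)

lemma sum_shift_power2:
  fixes f :: "nat \<Rightarrow> real"
  shows "(\<Sum>j=1..m. (f j + w)\<^sup>2) = (\<Sum>j=1..m. (f j)\<^sup>2) + 2 * (\<Sum>j=1..m. f j) * w + real m * w\<^sup>2"
  by (induction m) (simp_all add: algebra_simps power2_eq_square)

lemma momenta_sums:
  fixes v :: coords
  defines "Q \<equiv> \<lambda>m j. \<Sum>k=2..m. v k * jacobi_u (unit_coords j) k"
  assumes "1 \<le> m"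
  shows "(\<Sum>j=1..m. Q m j) = 0 \<and> (\<Sum>j=1..m. (Q m j)\<^sup>2) = (\<Sum>k=2..m. (v k)\<^sup>2 / jacobi_mass k)"
  using assms(2)
proof (induction m rule: dec_induct)
  case base
  then show ?case by (simp add: Q_def)
next
  case (step m)
  let ?w = "v (Suc m) / real m"
  have Q_old: "Q (Suc m) j = Q m j - ?w" if "j \<in> {1..m}" for j
    using that step by (simp add: Q_def jacobi_u_unit)
  have "Q m (Suc m) = 0"
    unfolding Q_def by (intro sum.neutral) (auto simp: jacobi_u_unit)
  then have Q_new: "Q (Suc m) (Suc m) = v (Suc m)"
    using step by (simp add: Q_def jacobi_u_unit)
  have "(\<Sum>j=1..Suc m. Q (Suc m) j) = (\<Sum>j=1..m. Q m j - ?w) + v (Suc m)"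
    using Q_old Q_new by simp
  also have "\<dots> = 0"
    using step by (simp add: sum_subtractf)
  finally have 1: "(\<Sum>j=1..Suc m. Q (Suc m) j) = 0" .
  have "(\<Sum>j=1..Suc m. (Q (Suc m) j)\<^sup>2) = (\<Sum>j=1..m. (Q m j - ?w)\<^sup>2) + (v (Suc m))\<^sup>2"
    using Q_old Q_new by simp
  also have "(\<Sum>j=1..m. (Q m j - ?w)\<^sup>2) =
      (\<Sum>j=1..m. (Q m j)\<^sup>2) + real m * ?w\<^sup>2 - 2 * (\<Sum>j=1..m. Q m j) * ?w"
    using sum_shift_power2[of "Q m" "- ?w" m] by simp
  also have "\<dots> + (v (Suc m))\<^sup>2 =
      (\<Sum>k=2..m. (v k)\<^sup>2 / jacobi_mass k) + (v (Suc m))\<^sup>2 / jacobi_mass (Suc m)"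
    using step by (simp add: jacobi_mass_def field_simps power2_eq_square)
  also have "\<dots> = (\<Sum>k=2..Suc m. (v k)\<^sup>2 / jacobi_mass k)"
    using step by simp
  finally show ?case using 1 by simp
qed

lemma J1_momenta_of:
  assumes "n \<ge> 1"
  shows "J1 n (\<phi>, momenta_of n v G) = G"
proof -
  have "(\<Sum>j=1..n. G * jacobi_g n (unit_coords j)) = G"
    using assms by (simp add: jacobi_g_def unit_coords_def)
  then show ?thesis
    using momenta_sums[OF assms, of v]
    by (simp add: J1_def momenta_of_def sum.distrib)
qed

lemma nbody_hamiltonian_reduces_to:
  assumes "n \<ge> 1" "reduces_to n c x y"
  shows "nbody_hamiltonian n x = reduced_hamiltonian n y + c\<^sup>2 / (2 * real n)"
proof -
  obtain \<phi> P u v where xy: "x = (\<phi>, P)" "y = (u, v)" by (metis surj_pair)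
  have u: "u k = jacobi_u \<phi> k" if "k \<in> {2..n}" for k
    using assms(2) that by (auto simp: reduces_to_def xy)
  have "angles_of n u j = angles_of n (jacobi_u \<phi>) j" if "j \<in> {1..n}" for j
    using that u by (auto simp: angles_of_def intro!: sum.cong)
  then have "\<phi> j = angles_of n u j + jacobi_g n \<phi>" if "j \<in> {1..n}" for j
    using that angles_of_jacobi_u[OF that] by simp
  then have pot: "potential n \<phi> = reduced_potential n u"
    unfolding reduced_potential_def by (rule potential_cong)
  let ?Q = "\<lambda>j. \<Sum>k=2..n. v k * jacobi_u (unit_coords j) k"
  have P: "P j = ?Q j + c / real n" if "j \<in> {1..n}" for j
    using assms(2) that
    by (simp add: reduces_to_def xy momenta_of_def jacobi_g_def unit_coords_def)
  have "(\<Sum>j=1..n. (P j)\<^sup>2) = (\<Sum>j=1..n. (?Q j + c / real n)\<^sup>2)"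
    using P by simp
  also have "\<dots> = (\<Sum>j=1..n. (?Q j)\<^sup>2) + 2 * (\<Sum>j=1..n. ?Q j) * (c / real n) + real n * (c / real n)\<^sup>2"
    by (rule sum_shift_power2)
  also have "\<dots> = (\<Sum>k=2..n. (v k)\<^sup>2 / jacobi_mass k) + c\<^sup>2 / real n"
    using momenta_sums[OF assms(1), of v] assms(1) by (simp add: power2_eq_square)
  finally have sq: "(\<Sum>j=1..n. (P j)\<^sup>2) = (\<Sum>k=2..n. (v k)\<^sup>2 / jacobi_mass k) + c\<^sup>2 / real n" .
  have "(\<Sum>k=2..n. (v k)\<^sup>2 / (2 * jacobi_mass k)) = (\<Sum>k=2..n. (v k)\<^sup>2 / jacobi_mass k) / 2"
    by (simp add: sum_divide_distrib mult.commute)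
  with sq have "(\<Sum>j=1..n. (P j)\<^sup>2 / 2) = (\<Sum>k=2..n. (v k)\<^sup>2 / (2 * jacobi_mass k)) + c\<^sup>2 / (2 * real n)"
    by (simp flip: sum_divide_distrib add: add_divide_distrib)
  then show ?thesis
    by (simp add: nbody_hamiltonian_def reduced_hamiltonian_def xy pot)
qed

end

theory Submission
  imports Defs
begin

text \<open>
  The kinetic energy is positive definite, so by the Lagrange--Dirichlet argument the equilibrium is
  stable as soon as the polygon is a strict local maximum of the potential \<open>U\<close>. The velocity
  \<open>\<alpha>\<close> disappears from the reduced problem, which is why stability holds for every \<open>\<alpha>\<close>.

  Since \<open>U\<close> is half the sum of \<open>cos x / |sin x|\<close> over the ordered pairs, its Hessian at the polygon
  is the circulant quadratic form in the differences \<open>x\<^sub>i - x\<^sub>j\<close> with weights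
  \<open>cos \<theta> / |sin \<theta>|^3\<close>, \<open>\<theta> = 2 \<pi> (i - j) / n\<close>. The discrete Fourier transform diagonalises it
  (\<open>circulant_form_fourier\<close>), with eigenvalues proportional to
  \<open>\<mu> r = \<Sum>\<^sub>m cos x\<^sub>m / |sin x\<^sub>m|^3 * sin\<^sup>2 (r x\<^sub>m)\<close>, \<open>x\<^sub>m = 2 \<pi> m / n\<close>; only odd \<open>n\<close> allows all
  frequencies to be written as \<open>2 r\<close>. Taking differences in \<open>r\<close> cancels the singular denominators:
  the second difference of \<open>\<mu>\<close> is \<open>2 C r\<close> with \<open>C r = \<Sum>\<^sub>m cos x\<^sub>m / |sin x\<^sub>m| * cos (2 r x\<^sub>m)\<close>, and the
  differences of \<open>C\<close> are geometric sums, equal to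
  \<open>tan (\<pi> (r+1) / n) + tan (\<pi> r / n) > 0\<close> for \<open>r < p\<close>. Hence the first difference of \<open>\<mu>\<close>, which starts
  at \<open>C 0 < 0\<close> and reaches 0 at \<open>r = p\<close> by symmetry, first decreases and then increases; it is negative
  before \<open>p\<close>, and \<open>\<mu> r < 0 = \<mu> 0\<close> for \<open>1 \<le> r \<le> p\<close> (\<open>polygon_mode_neg\<close>).

  A second order Taylor expansion turns this into two-sided quadratic bounds of the reduced energy by
  the distance to the equilibrium (\<open>reduced_energy_bounds\<close>), and conservation of energy confines every
  solution that starts close enough (\<open>energy_confinement\<close>).

  Stability also asks for solutions that exist for all times. The force is truncated near
  collisions so that it becomes globally Lipschitz; the truncated system has global solutions by
  Picard iteration, carried out as one application of the Banach fixed point theorem in an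
  exponentially weighted space (\<open>lipschitz_ode_global_solution\<close>), and since they are confined to the
  region where nothing was truncated, they solve the original system.
\<close>


section \<open>Global solutions of Lipschitz differential equations\<close>

lemma indefinite_integral_has_vector_derivative_halfline:
  fixes g :: "real \<Rightarrow> 'a::banach"
  assumes "continuous_on UNIV g" "t \<ge> 0"
  shows "((\<lambda>u. integral {0..u} g) has_vector_derivative g t) (at t within {0..})"
proof -
  have "((\<lambda>u. integral {0..u} g) has_vector_derivative g t) (at t within {0..t+1})"
    by (rule integral_has_vector_derivative) (use assms in \<open>auto intro: continuous_on_subset\<close>)
  moreover have "at t within {0..t+1} = at t within {0..}"
    by (rule at_within_nhd[of t "{..<t+1}"]) auto
  ultimately show ?thesis by simp
qed

lemma has_integral_exp_scaled:
  fixes K :: real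
  assumes "K > 0" "t \<ge> 0"
  shows "((\<lambda>s. exp (K * s)) has_integral (exp (K * t) - 1) / K) {0..t}"
proof -
  have "((\<lambda>s. exp (K * s)) has_integral (exp (K * t) / K - exp (K * 0) / K)) {0..t}"
    by (rule fundamental_theorem_of_calculus)
       (use assms in \<open>auto intro!: derivative_eq_intros simp: has_real_derivative_iff_has_vector_derivative[symmetric]\<close>)
  then show ?thesis by (simp add: diff_divide_distrib)
qed

text \<open>
  In the norm weighted by \<open>exp (- K t)\<close> integration from 0 is an operator of norm at most \<open>1 / K\<close>,
  uniformly in \<open>t\<close>. This makes the Picard operator contracting on the whole half-line at once, so
  that no local solutions have to be glued together.
\<close>

lemma norm_integral_exp_bound:
  fixes g :: "real \<Rightarrow> 'a::banach" and K :: real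
  assumes "continuous_on UNIV g" "K > 0" "t \<ge> 0" "B \<ge> 0"
    and "\<And>s. s \<ge> 0 \<Longrightarrow> norm (g s) \<le> B * exp (K * s)"
  shows "exp (- K * t) * norm (integral {0..t} g) \<le> B / K"
proof -
  have "norm (integral {0..t} g) \<le> integral {0..t} (\<lambda>s. B * exp (K * s))"
    by (rule integral_norm_bound_integral)
       (use assms in \<open>auto intro!: integrable_continuous_real continuous_intros intro: continuous_on_subset\<close>)
  also have "\<dots> = B * ((exp (K * t) - 1) / K)"
    using has_integral_exp_scaled[of K t] assms by (intro integral_unique has_integral_mult_right) auto
  also have "\<dots> \<le> B * (exp (K * t) / K)"
    using assms by (intro mult_left_mono divide_right_mono) auto
  finally have "exp (- K * t) * norm (integral {0..t} g) \<le> exp (- K * t) * (B * (exp (K * t) / K))"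
    by (rule mult_left_mono) auto
  also have "\<dots> = B / K" by (simp add: exp_minus field_simps)
  finally show ?thesis .
qed

text \<open>
  The solution is sought as \<open>z t = x0 + exp (K t) y t\<close> with \<open>y\<close> bounded and continuous. For
  \<open>K \<ge> 2 L\<close> the integral equation for \<open>y\<close> is a contraction with factor \<open>1/2\<close>.
\<close>

theorem lipschitz_ode_global_solution:
  fixes F :: "'a::banach \<Rightarrow> 'a"
  assumes lip: "L-lipschitz_on UNIV F"
  shows "\<exists>z. z 0 = x0 \<and> (\<forall>t\<ge>0. (z has_vector_derivative F (z t)) (at t within {0..}))"
proof -
  have L0: "L \<ge> 0" using lip by (rule lipschitz_on_nonneg)
  have contF: "continuous_on UNIV F" by (rule lipschitz_on_continuous_on[OF lip])
  have LF: "norm (F a - F b) \<le> L * norm (a - b)" for a b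
    using lipschitz_on_normD[OF lip, of a b] by simp
  define K where "K = 2 * L + 1"
  have K: "K > 0" "L / K \<le> 1 / 2" using L0 by (auto simp: K_def field_simps)
  define w :: "(real \<Rightarrow>\<^sub>C 'a) \<Rightarrow> real \<Rightarrow> 'a" where
    "w y s = x0 + exp (K * s) *\<^sub>R apply_bcontfun y s" for y s
  \<comment> \<open>Negative times are clamped to 0, which makes the operator act on functions on the whole real line.\<close>
  define A :: "(real \<Rightarrow>\<^sub>C 'a) \<Rightarrow> real \<Rightarrow> 'a" where
    "A y t = exp (- K * max 0 t) *\<^sub>R integral {0..max 0 t} (\<lambda>s. F (w y s))" for y t
  have contw: "continuous_on UNIV (\<lambda>s. F (w y s))" for y
    by (rule continuous_on_compose2[OF contF])
       (auto simp: w_def intro!: continuous_intros)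
  have bound: "norm (A y t) \<le> (norm (F x0) + L * norm y) / K" for y t
  proof -
    have "norm (F (w y s)) \<le> (norm (F x0) + L * norm y) * exp (K * s)" if "s \<ge> 0" for s
    proof -
      have "norm (F (w y s)) \<le> norm (F x0) + norm (F (w y s) - F x0)"
        by (metis add.commute diff_add_cancel norm_triangle_ineq)
      also have "\<dots> \<le> norm (F x0) + L * norm (w y s - x0)" using LF by simp
      also have "\<dots> \<le> norm (F x0) * exp (K * s) + L * (exp (K * s) * norm y)"
        using that K L0
        by (intro add_mono mult_left_mono) (auto simp: w_def norm_bounded mult_le_cancel_left1)
      finally show ?thesis by (simp add: algebra_simps)
    qed
    then show ?thesis
      using norm_integral_exp_bound[OF contw, of K "max 0 t" "norm (F x0) + L * norm y" y] K L0
      by (simp add: A_def)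
  qed
  have "continuous_on {0..} (\<lambda>t. integral {0..t} (\<lambda>s. F (w y s)))" for y
    by (rule continuous_on_vector_derivative, rule indefinite_integral_has_vector_derivative_halfline[OF contw]) auto
  then have contI: "continuous_on UNIV (\<lambda>t. integral {0..max 0 t} (\<lambda>s. F (w y s)))" for y
    by (rule continuous_on_compose2) (auto intro!: continuous_intros)
  have A_in: "A y \<in> bcontfun" for y
    by (rule bcontfun_normI[OF _ bound]) (auto simp: A_def[abs_def] intro!: continuous_intros contI)
  have contraction: "dist (Bcontfun (A y)) (Bcontfun (A y')) \<le> 1 / 2 * dist y y'" for y y'
  proof (rule dist_bound)
    fix t :: real
    let ?t = "max 0 t"
    have "A y t - A y' t = exp (- K * ?t) *\<^sub>R integral {0..?t} (\<lambda>s. F (w y s) - F (w y' s))"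
      unfolding A_def using contw
      by (subst integral_diff)
         (auto intro!: integrable_continuous_real intro: continuous_on_subset simp: scaleR_diff_right)
    moreover have "exp (- K * ?t) * norm (integral {0..?t} (\<lambda>s. F (w y s) - F (w y' s))) \<le> L * dist y y' / K"
    proof (rule norm_integral_exp_bound)
      fix s :: real
      have "norm (F (w y s) - F (w y' s)) \<le> L * norm (w y s - w y' s)" by (rule LF)
      also have "w y s - w y' s = exp (K * s) *\<^sub>R (y s - y' s)"
        by (simp add: w_def scaleR_diff_right)
      also have "L * norm \<dots> \<le> L * (exp (K * s) * dist y y')"
        using dist_bounded[of y s y'] L0 by (intro mult_left_mono) (auto simp: dist_norm)
      finally show "norm (F (w y s) - F (w y' s)) \<le> L * dist y y' * exp (K * s)"
        by (simp add: mult_ac)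
    qed (use K L0 contw in \<open>auto intro!: continuous_intros\<close>)
    ultimately have "dist (A y t) (A y' t) \<le> (L / K) * dist y y'"
      by (simp add: dist_norm)
    also have "\<dots> \<le> 1 / 2 * dist y y'" using K by (intro mult_right_mono) auto
    finally show "dist (apply_bcontfun (Bcontfun (A y)) t) (apply_bcontfun (Bcontfun (A y')) t) \<le> 1 / 2 * dist y y'"
      using A_in by (simp add: Bcontfun_inverse)
  qed
  then obtain y where "Bcontfun (A y) = y"
    using banach_fix_type[of "1/2" "\<lambda>y. Bcontfun (A y)"] by auto
  then have y: "apply_bcontfun y = A y" using Bcontfun_inverse[OF A_in[of y]] by simp
  define z where "z t = x0 + integral {0..t} (\<lambda>s. F (w y s))" for t
  have zw: "w y t = z t" if "t \<ge> 0" for t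
  proof -
    have "exp (K * t) * exp (- K * t) = 1" by (simp flip: exp_add)
    moreover have "apply_bcontfun y t = exp (- K * t) *\<^sub>R integral {0..t} (\<lambda>s. F (w y s))"
      unfolding y by (simp add: A_def that)
    ultimately show ?thesis by (simp add: w_def[of y t] z_def)
  qed
  have "(z has_vector_derivative F (z t)) (at t within {0..})" if "t \<ge> 0" for t
  proof -
    have "(z has_vector_derivative F (w y t)) (at t within {0..})"
      using has_vector_derivative_add[OF has_vector_derivative_const
          indefinite_integral_has_vector_derivative_halfline[OF contw that], of x0 y]
      by (simp add: z_def[abs_def])
    then show ?thesis by (simp only: zw[OF that])
  qed
  moreover have "z 0 = x0" by (simp add: z_def)
  ultimately show ?thesis by blast
qed

text \<open>
  In the following rules the Lipschitz constant is existentially quantified, so that they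
  can be chained by backward resolution without computing any constant.
\<close>

lemma lipschitz_on_sum_exists:
  fixes f :: "'i \<Rightarrow> 'a::metric_space \<Rightarrow> 'b::real_normed_vector"
  assumes "\<And>i. i \<in> A \<Longrightarrow> \<exists>L. L-lipschitz_on S (f i)"
  shows "\<exists>L. L-lipschitz_on S (\<lambda>x. \<Sum>i\<in>A. f i x)"
  using assms
proof (induction A rule: infinite_finite_induct)
  case (insert i A)
  then obtain L M where "L-lipschitz_on S (f i)" "M-lipschitz_on S (\<lambda>x. \<Sum>i\<in>A. f i x)" by blast
  from lipschitz_on_add[OF this] show ?case using insert.hyps by auto
qed (auto intro: lipschitz_on_constant)

lemma lipschitz_on_scaleR_const_exists:
  fixes g :: "'a::metric_space \<Rightarrow> real" and w :: "'b::real_normed_vector"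
  assumes "\<exists>L. L-lipschitz_on S g"
  shows "\<exists>L. L-lipschitz_on S (\<lambda>x. g x *\<^sub>R w)"
proof -
  obtain L where L: "L-lipschitz_on S g" using assms by blast
  have "(L * norm w)-lipschitz_on S (\<lambda>x. g x *\<^sub>R w)"
  proof (rule lipschitz_onI)
    fix x y assume xy: "x \<in> S" "y \<in> S"
    have "dist (g x *\<^sub>R w) (g y *\<^sub>R w) = dist (g x) (g y) * norm w"
      by (simp add: dist_norm flip: scaleR_diff_left)
    also have "\<dots> \<le> (L * dist x y) * norm w"
      using lipschitz_onD[OF L xy] by (rule mult_right_mono) simp
    finally show "dist (g x *\<^sub>R w) (g y *\<^sub>R w) \<le> L * norm w * dist x y" by (simp add: mult_ac)
  qed (use lipschitz_on_nonneg[OF L] in simp)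
  then show ?thesis ..
qed

lemma lipschitz_on_diff_exists:
  fixes f g :: "'a::metric_space \<Rightarrow> 'b::real_normed_vector"
  assumes "\<exists>L. L-lipschitz_on S f" "\<exists>L. L-lipschitz_on S g"
  shows "\<exists>L. L-lipschitz_on S (\<lambda>x. f x - g x)"
  using assms lipschitz_on_diff by blast

lemma lipschitz_on_cmult_exists:
  fixes g :: "'a::metric_space \<Rightarrow> real"
  assumes "\<exists>L. L-lipschitz_on S g"
  shows "\<exists>L. L-lipschitz_on S (\<lambda>x. c * g x)"
  using lipschitz_on_scaleR_const_exists[OF assms, of c] by (simp add: mult.commute)

lemma lipschitz_on_compose_exists:
  assumes "\<exists>L. L-lipschitz_on UNIV g" "\<exists>L. L-lipschitz_on S f"
  shows "\<exists>L. L-lipschitz_on S (\<lambda>x. g (f x))"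
proof -
  obtain L M where L: "L-lipschitz_on UNIV g" and M: "M-lipschitz_on S f" using assms by blast
  have "L-lipschitz_on (f ` S) g" using L by (rule lipschitz_on_subset) simp
  from lipschitz_on_compose2[OF M this] show ?thesis by blast
qed

instance bcontfun :: (metric_space, banach) banach ..

text \<open>
  Coordinate families are embedded into a Banach space in which the existence theorem applies: a
  bounded continuous function on the real line carries the family of its values at the natural
  numbers, and the hat functions of width 1 play the role of the unit vectors. One Banach space
  serves all dimensions, so that the number of coordinates may be a variable.
\<close>

definition samples :: "(real \<Rightarrow>\<^sub>C real) \<Rightarrow> coords" where
  "samples x i = apply_bcontfun x (real i)"

definition hat :: "nat \<Rightarrow> real \<Rightarrow>\<^sub>C real" where
  "hat k = Bcontfun (\<lambda>x. max 0 (1 - \<bar>x - real k\<bar>))"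

lemma samples_hat: "samples (hat k) i = (if i = k then 1 else 0)"
proof -
  have "(\<lambda>x. max 0 (1 - \<bar>x - real k\<bar>)) \<in> bcontfun"
    by (rule bcontfun_normI[of _ 1]) (auto intro!: continuous_intros)
  moreover have "max 0 (1 - \<bar>real i - real k\<bar>) = (if i = k then 1 else 0)"
  proof (cases "i = k")
    case False
    then have "\<bar>int i - int k\<bar> \<ge> 1" by simp
    then have "\<bar>real i - real k\<bar> \<ge> 1" by linarith
    then show ?thesis using False by simp
  qed simp
  ultimately show ?thesis by (simp add: samples_def hat_def Bcontfun_inverse)
qed

lemma bounded_linear_samples: "bounded_linear (\<lambda>x. samples x i)"
  by (rule bounded_linear_intro[of _ 1]) (auto simp: samples_def norm_bounded[where 'b = real, simplified])

lemma samples_sum_hat: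
  assumes "finite I"
  shows "samples (\<Sum>k\<in>I. c k *\<^sub>R hat k) i = (if i \<in> I then c i else 0)"
proof -
  have "samples (\<Sum>k\<in>I. c k *\<^sub>R hat k) i = (\<Sum>k\<in>I. samples (c k *\<^sub>R hat k) i)"
    by (rule linear_sum[OF bounded_linear.linear[OF bounded_linear_samples]])
  also have "\<dots> = (\<Sum>k\<in>I. if i = k then c k else 0)"
    using samples_hat by (intro sum.cong refl) (simp add: samples_def)
  finally have "samples (\<Sum>k\<in>I. c k *\<^sub>R hat k) i = (\<Sum>k\<in>I. if i = k then c k else 0)" .
  then show ?thesis using assms by simp
qed

lemma lipschitz_coordinate:
  "\<exists>L. L-lipschitz_on UNIV (\<lambda>z :: (real \<Rightarrow>\<^sub>C real) \<times> (real \<Rightarrow>\<^sub>C real). samples (fst z) k)"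
  "\<exists>L. L-lipschitz_on UNIV (\<lambda>z :: (real \<Rightarrow>\<^sub>C real) \<times> (real \<Rightarrow>\<^sub>C real). samples (snd z) k)"
proof -
  have "1-lipschitz_on UNIV (\<lambda>z :: (real \<Rightarrow>\<^sub>C real) \<times> (real \<Rightarrow>\<^sub>C real). samples (fst z) k)"
    by (rule lipschitz_onI) (auto simp: samples_def intro: order_trans[OF dist_bounded dist_fst_le])
  moreover have "1-lipschitz_on UNIV (\<lambda>z :: (real \<Rightarrow>\<^sub>C real) \<times> (real \<Rightarrow>\<^sub>C real). samples (snd z) k)"
    by (rule lipschitz_onI) (auto simp: samples_def intro: order_trans[OF dist_bounded dist_snd_le])
  ultimately show
    "\<exists>L. L-lipschitz_on UNIV (\<lambda>z :: (real \<Rightarrow>\<^sub>C real) \<times> (real \<Rightarrow>\<^sub>C real). samples (fst z) k)"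
    "\<exists>L. L-lipschitz_on UNIV (\<lambda>z :: (real \<Rightarrow>\<^sub>C real) \<times> (real \<Rightarrow>\<^sub>C real). samples (snd z) k)"
    by blast+
qed

text \<open>
  The coordinates outside the index set keep their initial values in the solution, whereas the
  right-hand sides see them as 0; this lets the initial state be prescribed on all indices.
\<close>

lemma lipschitz_system_global_solution:
  fixes f g :: "nat \<Rightarrow> coords \<Rightarrow> coords \<Rightarrow> real"
  assumes I: "finite I"
    and f: "\<And>k. k \<in> I \<Longrightarrow> \<exists>L. L-lipschitz_on UNIV (\<lambda>z. f k (samples (fst z)) (samples (snd z)))"
    and g: "\<And>k. k \<in> I \<Longrightarrow> \<exists>L. L-lipschitz_on UNIV (\<lambda>z. g k (samples (fst z)) (samples (snd z)))"
  shows "\<exists>u v. u 0 = u0 \<and> v 0 = v0 \<and> (\<forall>t\<ge>0. \<forall>k\<in>I.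
     ((\<lambda>t. u t k) has_real_derivative f k (\<lambda>i. if i \<in> I then u t i else 0) (\<lambda>i. if i \<in> I then v t i else 0)) (at t within {0..}) \<and>
     ((\<lambda>t. v t k) has_real_derivative g k (\<lambda>i. if i \<in> I then u t i else 0) (\<lambda>i. if i \<in> I then v t i else 0)) (at t within {0..}))"
proof -
  define F :: "(real \<Rightarrow>\<^sub>C real) \<times> (real \<Rightarrow>\<^sub>C real) \<Rightarrow> (real \<Rightarrow>\<^sub>C real) \<times> (real \<Rightarrow>\<^sub>C real)" where
    "F z = (\<Sum>k\<in>I. f k (samples (fst z)) (samples (snd z)) *\<^sub>R hat k,
            \<Sum>k\<in>I. g k (samples (fst z)) (samples (snd z)) *\<^sub>R hat k)" for z
  define z0 where "z0 = (\<Sum>k\<in>I. u0 k *\<^sub>R hat k, \<Sum>k\<in>I. v0 k *\<^sub>R hat k)"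
  have lip: "\<exists>L. L-lipschitz_on UNIV (\<lambda>z :: (real \<Rightarrow>\<^sub>C real) \<times> (real \<Rightarrow>\<^sub>C real).
      \<Sum>k\<in>I. h k (samples (fst z)) (samples (snd z)) *\<^sub>R hat k)"
    if "\<And>k. k \<in> I \<Longrightarrow> \<exists>L. L-lipschitz_on UNIV (\<lambda>z. h k (samples (fst z)) (samples (snd z)))"
    for h :: "nat \<Rightarrow> coords \<Rightarrow> coords \<Rightarrow> real"
    by (intro lipschitz_on_sum_exists lipschitz_on_scaleR_const_exists that)
  obtain L where L: "L-lipschitz_on UNIV (\<lambda>z :: (real \<Rightarrow>\<^sub>C real) \<times> (real \<Rightarrow>\<^sub>C real).
      \<Sum>k\<in>I. f k (samples (fst z)) (samples (snd z)) *\<^sub>R hat k)"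
    using lip[of f, OF f] by blast
  obtain M where M: "M-lipschitz_on UNIV (\<lambda>z :: (real \<Rightarrow>\<^sub>C real) \<times> (real \<Rightarrow>\<^sub>C real).
      \<Sum>k\<in>I. g k (samples (fst z)) (samples (snd z)) *\<^sub>R hat k)"
    using lip[of g, OF g] by blast
  from lipschitz_on_Pair[OF L M] obtain K where "K-lipschitz_on UNIV F" unfolding F_def[abs_def] by blast
  from lipschitz_ode_global_solution[OF this, of z0]
  obtain z where z0: "z 0 = z0" and z: "\<And>t. t \<ge> 0 \<Longrightarrow> (z has_vector_derivative F (z t)) (at t within {0..})"
    by blast
  have z1: "((\<lambda>t. samples (fst (z t)) k) has_real_derivative samples (fst (F (z t))) k) (at t within {0..})"
    and z2: "((\<lambda>t. samples (snd (z t)) k) has_real_derivative samples (snd (F (z t))) k) (at t within {0..})"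
    if "t \<ge> 0" for t k
    using bounded_linear.has_vector_derivative[OF bounded_linear_compose[OF bounded_linear_samples[of k] bounded_linear_fst] z[OF that]]
      bounded_linear.has_vector_derivative[OF bounded_linear_compose[OF bounded_linear_samples[of k] bounded_linear_snd] z[OF that]]
    by (simp_all add: has_real_derivative_iff_has_vector_derivative)
  define U where "U t k = (if k \<in> I then samples (fst (z t)) k else u0 k)" for t k
  define V where "V t k = (if k \<in> I then samples (snd (z t)) k else v0 k)" for t k
  \<comment> \<open>Coordinates outside the index set start at zero and have zero velocity.\<close>
  have rest: "samples (fst (z t)) k = 0 \<and> samples (snd (z t)) k = 0" if "t \<ge> 0" "k \<notin> I" for t k
  proof -
    have 0: "samples (fst (F w)) k = 0" "samples (snd (F w)) k = 0" for w
      using that I by (simp_all add: F_def samples_sum_hat)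
    have "\<exists>c. \<forall>t\<in>{0..}. samples (fst (z t)) k = c"
      by (rule has_field_derivative_zero_constant) (use z1[of _ k] 0 in auto)
    moreover have "\<exists>c. \<forall>t\<in>{0..}. samples (snd (z t)) k = c"
      by (rule has_field_derivative_zero_constant) (use z2[of _ k] 0 in auto)
    moreover have "samples (fst (z 0)) k = 0" "samples (snd (z 0)) k = 0"
      using that I by (simp_all add: z0 z0_def samples_sum_hat)
    ultimately show ?thesis using that by force
  qed
  show ?thesis
  proof (rule exI[of _ U], rule exI[of _ V], intro conjI allI impI ballI)
    show "U 0 = u0" "V 0 = v0"
      using I by (auto simp: U_def V_def z0 z0_def samples_sum_hat)
    fix t :: real and k assume t: "t \<ge> 0" and k: "k \<in> I"
    have UV: "(\<lambda>i. if i \<in> I then U t i else 0) = samples (fst (z t))"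
      "(\<lambda>i. if i \<in> I then V t i else 0) = samples (snd (z t))"
      using rest[OF t] by (auto simp: U_def V_def fun_eq_iff)
    show "((\<lambda>t. U t k) has_real_derivative f k (\<lambda>i. if i \<in> I then U t i else 0) (\<lambda>i. if i \<in> I then V t i else 0)) (at t within {0..})"
      "((\<lambda>t. V t k) has_real_derivative g k (\<lambda>i. if i \<in> I then U t i else 0) (\<lambda>i. if i \<in> I then V t i else 0)) (at t within {0..})"
      using z1[OF t, of k] z2[OF t, of k] k I unfolding UV
      by (simp_all add: U_def V_def F_def samples_sum_hat)
  qed
qed


section \<open>The pair interaction\<close>

definition pair_potential :: "real \<Rightarrow> real" where
  "pair_potential x = cos x / \<bar>sin x\<bar>"

text \<open>
  The derivative of the pair potential, extended by 0 to collisions. That value makes the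
  double sums below include their diagonal terms.
\<close>

definition pair_force :: "real \<Rightarrow> real" where
  "pair_force x = - sin x / \<bar>sin x\<bar> ^ 3"

lemma cot_circle_dist: "cot (circle_dist a b) = pair_potential (a - b)"
proof -
  have "sin (arccos (cos (a - b))) = sqrt (1 - (cos (a - b))\<^sup>2)"
    by (rule sin_arccos) (auto simp: cos_ge_minus_one cos_le_one)
  also have "\<dots> = \<bar>sin (a - b)\<bar>" by (simp flip: sin_squared_eq)
  finally show ?thesis by (simp add: circle_dist_def cot_def pair_potential_def cos_arccos)
qed

text \<open>
  Away from collisions \<open>|sin|\<close> is \<open>sin\<close> up to a locally constant sign, so the functions above can be
  differentiated as if there were no absolute value.
\<close>

lemma abs_sin_locally:
  assumes "sin (x::real) \<noteq> 0"
  shows "\<forall>\<^sub>F y in nhds x. \<bar>sin y\<bar> = sgn (sin x) * sin y \<and> sin y \<noteq> 0"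
proof -
  have "isCont sin x" by simp
  then have t: "(sin \<longlongrightarrow> sin x) (nhds x)" by (simp add: isCont_def tendsto_at_iff_tendsto_nhds)
  show ?thesis
  proof (cases "sin x > 0")
    case True
    show ?thesis using order_tendstoD(1)[OF t True] by eventually_elim (use True in auto)
  next
    case False
    then have "sin x < 0" using assms by simp
    then show ?thesis using order_tendstoD(2)[OF t, of 0] by (auto elim: eventually_mono)
  qed
qed

lemma pair_potential_has_derivative:
  assumes "sin x \<noteq> 0"
  shows "(pair_potential has_real_derivative pair_force x) (at x)"
proof -
  define \<sigma> where "\<sigma> = sgn (sin x)"
  have \<sigma>: "\<sigma> * \<sigma> = 1" "1 / \<sigma> = \<sigma>" "\<bar>sin x\<bar> = \<sigma> * sin x" "\<sigma> \<noteq> 0" using assms by (auto simp: \<sigma>_def sgn_if)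
  have "((\<lambda>y. cos y / (\<sigma> * sin y)) has_real_derivative pair_force x) (at x)"
  proof -
    have eq: "(- (sin x) * (\<sigma> * sin x) - cos x * (\<sigma> * cos x)) / ((\<sigma> * sin x) * (\<sigma> * sin x)) = pair_force x"
    proof -
      have "- (sin x) * (\<sigma> * sin x) - cos x * (\<sigma> * cos x) = - \<sigma> * ((sin x)\<^sup>2 + (cos x)\<^sup>2)"
        by algebra
      also have "\<dots> = - \<sigma>" by simp
      finally have num: "- (sin x) * (\<sigma> * sin x) - cos x * (\<sigma> * cos x) = - \<sigma>" .
      have "(\<sigma> * sin x) * (\<sigma> * sin x) = (\<sigma> * \<sigma>) * (sin x)\<^sup>2" by algebra
      then have den: "(\<sigma> * sin x) * (\<sigma> * sin x) = (sin x)\<^sup>2" using \<sigma> by simp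
      have "\<bar>sin x\<bar> ^ 3 = \<sigma> * sin x * (sin x)\<^sup>2"
        using \<sigma>(1,3) by (simp add: power3_eq_cube power2_eq_square)
      then have "pair_force x = - (1 / \<sigma>) / (sin x)\<^sup>2"
        using assms by (simp add: pair_force_def)
      then show ?thesis unfolding num den using \<sigma>(2) by simp
    qed
    have "((\<lambda>y. cos y / (\<sigma> * sin y)) has_real_derivative
        (- (sin x) * (\<sigma> * sin x) - cos x * (\<sigma> * cos x)) / ((\<sigma> * sin x) * (\<sigma> * sin x))) (at x)"
      by (rule DERIV_divide) (use assms \<sigma>(4) in \<open>auto intro!: derivative_eq_intros\<close>)
    then show ?thesis unfolding eq .
  qed
  moreover have "\<forall>\<^sub>F y in nhds x. pair_potential y = cos y / (\<sigma> * sin y)"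
    using abs_sin_locally[OF assms] by eventually_elim (simp add: pair_potential_def \<sigma>_def)
  ultimately show ?thesis by (subst DERIV_cong_ev[OF refl _ refl])
qed

lemma pair_force_has_derivative:
  assumes "sin x \<noteq> 0"
  shows "(pair_force has_real_derivative 2 * cos x / \<bar>sin x\<bar> ^ 3) (at x)"
proof -
  define \<sigma> where "\<sigma> = sgn (sin x)"
  have \<sigma>: "\<sigma> * \<sigma> = 1" "\<bar>sin x\<bar> = \<sigma> * sin x" "\<sigma> \<noteq> 0" "\<sigma>\<^sup>2 = 1" "1 / \<sigma> = \<sigma>" using assms by (auto simp: \<sigma>_def sgn_if)
  have "((\<lambda>y. - \<sigma> / (sin y)\<^sup>2) has_real_derivative 2 * cos x / \<bar>sin x\<bar> ^ 3) (at x)"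
  proof -
    have "2 * cos x / \<bar>sin x\<bar> ^ 3 = 2 * cos x * (1 / \<sigma>) / (sin x) ^ 3"
      unfolding \<sigma>(2) using \<sigma>(3,4) by (simp add: power_mult_distrib power3_eq_cube power2_eq_square)
    then have "2 * cos x / \<bar>sin x\<bar> ^ 3 = 2 * cos x * \<sigma> / (sin x) ^ 3" using \<sigma>(5) by simp
    then show ?thesis
      using assms by (auto intro!: derivative_eq_intros simp: field_simps power2_eq_square power3_eq_cube)
  qed
  moreover have "\<forall>\<^sub>F y in nhds x. pair_force y = - \<sigma> / (sin y)\<^sup>2"
    using abs_sin_locally[OF assms]
  proof eventually_elim
    case (elim y)
    have "\<bar>sin y\<bar> ^ 3 = \<sigma> * sin y * (sin y)\<^sup>2"
      using elim by (simp add: power3_eq_cube power2_eq_square \<sigma>_def \<open>sin x \<noteq> 0\<close> sgn_eq_0_iff)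
    moreover have "1 / \<sigma> = \<sigma>" by fact
    ultimately show ?case using elim \<sigma> by (simp add: pair_force_def field_simps)
  qed
  ultimately show ?thesis by (subst DERIV_cong_ev[OF refl _ refl])
qed

text \<open>
  Taylor expansion with Peano remainder: the derivative of the remainder is \<open>o(h)\<close> because
  \<open>f'\<close> is differentiable at the point, and the mean value inequality integrates this bound.
\<close>

lemma taylor2_squeeze:
  fixes f f' :: "real \<Rightarrow> real"
  assumes f: "\<forall>\<^sub>F y in nhds x. (f has_real_derivative f' y) (at y)"
    and f': "(f' has_real_derivative f2) (at x)" and "\<eta> > 0"
  shows "\<exists>\<rho>>0. \<forall>h. \<bar>h\<bar> < \<rho> \<longrightarrow> \<bar>f (x + h) - f x - f' x * h - f2 / 2 * h\<^sup>2\<bar> \<le> \<eta> * h\<^sup>2"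
proof -
  obtain d where d: "d > 0" "\<And>y. dist y x < d \<Longrightarrow> (f has_real_derivative f' y) (at y)"
    using f by (auto simp: eventually_nhds_metric)
  have "((\<lambda>h. (f' (x + h) - f' x) / h) \<longlongrightarrow> f2) (at 0)" using f' by (simp add: DERIV_def)
  from tendstoD[OF this \<open>\<eta> > 0\<close>]
  obtain e where e: "e > 0" "\<And>h. h \<noteq> 0 \<Longrightarrow> \<bar>h\<bar> < e \<Longrightarrow> \<bar>(f' (x + h) - f' x) / h - f2\<bar> < \<eta>"
    unfolding eventually_at by (auto simp: dist_real_def)
  have lin: "\<bar>f' (x + h) - f' x - f2 * h\<bar> \<le> \<eta> * \<bar>h\<bar>" if "\<bar>h\<bar> < e" for h
  proof (cases "h = 0")
    case False
    have "f' (x + h) - f' x - f2 * h = ((f' (x + h) - f' x) / h - f2) * h"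
      using False by (simp add: field_simps)
    then show ?thesis using e(2)[OF False that] by (simp add: abs_mult mult_right_mono)
  qed simp
  show ?thesis
  proof (intro exI[of _ "min d e"] conjI allI impI)
    show "min d e > 0" using d e by simp
    fix h :: real assume h: "\<bar>h\<bar> < min d e"
    define r where "r k = f (x + k) - f x - f' x * k - f2 / 2 * k\<^sup>2" for k
    have "((\<lambda>k. f (x + k)) has_real_derivative f' (x + k)) (at k)" if "\<bar>k\<bar> < d" for k
      using d(2)[of "x + k"] that DERIV_shift[of f "f' (x + k)" k x] by (simp add: dist_real_def add.commute)
    then have r': "(r has_real_derivative (f' (x + k) - f' x - f2 * k)) (at k)" if "\<bar>k\<bar> < d" for k
      unfolding r_def[abs_def] using that by (auto intro!: derivative_eq_intros)
    have "norm (r h - r 0) \<le> (\<eta> * \<bar>h\<bar>) * norm (h - 0)"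
    proof (rule field_differentiable_bound[of "cball 0 \<bar>h\<bar>"])
      fix k :: real assume "k \<in> cball 0 \<bar>h\<bar>"
      then have k: "\<bar>k\<bar> \<le> \<bar>h\<bar>" by simp
      show "(r has_field_derivative (f' (x + k) - f' x - f2 * k)) (at k within cball 0 \<bar>h\<bar>)"
        using r' h k by (intro has_field_derivative_at_within[OF r']) auto
      show "norm (f' (x + k) - f' x - f2 * k) \<le> \<eta> * \<bar>h\<bar>"
        using order_trans[OF lin[of k] mult_left_mono[OF k, of \<eta>]] k h \<open>\<eta> > 0\<close> by simp
    qed auto
    then show "\<bar>f (x + h) - f x - f' x * h - f2 / 2 * h\<^sup>2\<bar> \<le> \<eta> * h\<^sup>2"
      by (simp add: r_def power2_eq_square mult.assoc)
  qed
qed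

lemma pair_potential_taylor:
  assumes "sin x \<noteq> 0" "\<eta> > 0"
  shows "\<exists>\<rho>>0. \<forall>h. \<bar>h\<bar> < \<rho> \<longrightarrow>
    \<bar>pair_potential (x + h) - pair_potential x - pair_force x * h - cos x / \<bar>sin x\<bar> ^ 3 * h\<^sup>2\<bar> \<le> \<eta> * h\<^sup>2"
proof -
  have "\<forall>\<^sub>F y in nhds x. (pair_potential has_real_derivative pair_force y) (at y)"
    using abs_sin_locally[OF assms(1)] by eventually_elim (auto intro: pair_potential_has_derivative)
  from taylor2_squeeze[OF this pair_force_has_derivative[OF assms(1)] assms(2)]
  show ?thesis by simp
qed

lemma sum_pairs_symmetric:
  fixes g :: "nat \<Rightarrow> nat \<Rightarrow> real"
  assumes "\<And>i j. g i j = g j i" "\<And>i. g i i = 0"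
  shows "2 * (\<Sum>i=1..n. \<Sum>j=i+1..n. g i j) = (\<Sum>i=1..n. \<Sum>j=1..n. g i j)"
proof (induction n)
  case (Suc n)
  have "(\<Sum>i=1..Suc n. \<Sum>j=i+1..Suc n. g i j) = (\<Sum>i=1..n. \<Sum>j=i+1..Suc n. g i j)"
    by (subst sum.cl_ivl_Suc) simp
  also have "\<dots> = (\<Sum>i=1..n. (\<Sum>j=i+1..n. g i j) + g i (Suc n))"
    by (intro sum.cong refl, subst sum.cl_ivl_Suc) simp
  finally have "(\<Sum>i=1..Suc n. \<Sum>j=i+1..Suc n. g i j) = (\<Sum>i=1..n. \<Sum>j=i+1..n. g i j) + (\<Sum>i=1..n. g i (Suc n))"
    by (simp only: sum.distrib)
  moreover have "(\<Sum>j=1..n. g (Suc n) j) = (\<Sum>j=1..n. g j (Suc n))"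
    by (intro sum.cong refl assms(1))
  moreover have "(\<Sum>i=1..Suc n. \<Sum>j=1..Suc n. g i j) =
      (\<Sum>i=1..n. \<Sum>j=1..n. g i j) + (\<Sum>i=1..n. g i (Suc n)) + ((\<Sum>j=1..n. g (Suc n) j) + g (Suc n) (Suc n))"
    by (simp add: sum.distrib)
  ultimately show ?case using Suc assms(2)[of "Suc n"] by linarith
qed simp

lemma potential_as_double_sum:
  "potential n \<phi> = (\<Sum>i=1..n. \<Sum>j=1..n. pair_potential (\<phi> i - \<phi> j)) / 2"
proof -
  have "pair_potential (- x) = pair_potential x" for x by (simp add: pair_potential_def)
  from this[of "\<phi> j - \<phi> i" for i j]
  have sym: "pair_potential (\<phi> i - \<phi> j) = pair_potential (\<phi> j - \<phi> i)" for i j by simp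
  have "2 * potential n \<phi> = (\<Sum>i=1..n. \<Sum>j=1..n. pair_potential (\<phi> i - \<phi> j))"
    unfolding potential_def cot_circle_dist
    by (rule sum_pairs_symmetric, rule sym) (simp add: pair_potential_def)
  then show ?thesis by simp
qed

definition torque :: "nat \<Rightarrow> coords \<Rightarrow> nat \<Rightarrow> real" where
  "torque n \<phi> i = (\<Sum>j=1..n. pair_force (\<phi> i - \<phi> j))"

lemma collision_free_iff_sin:
  "collision_free n \<phi> \<longleftrightarrow> (\<forall>i\<in>{1..n}. \<forall>j\<in>{1..n}. i \<noteq> j \<longrightarrow> sin (\<phi> i - \<phi> j) \<noteq> 0)"
  unfolding collision_free_def sin_zero_iff_int2 by (auto simp: image_iff)

text \<open>
  Action equals reaction: the virtual work of the pair forces under a displacement \<open>d\<close>.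
\<close>

lemma sum_pair_force_diff:
  "(\<Sum>i=1..n. \<Sum>j=1..n. pair_force (\<phi> i - \<phi> j) * (d i - d j)) = 2 * (\<Sum>i=1..n. d i * torque n \<phi> i)"
proof -
  have odd: "pair_force (- x) = - pair_force x" for x by (simp add: pair_force_def)
  have "(\<Sum>i=1..n. \<Sum>j=1..n. pair_force (\<phi> i - \<phi> j) * d j) =
      (\<Sum>i=1..n. \<Sum>j=1..n. pair_force (\<phi> j - \<phi> i) * d i)" by (rule sum.swap)
  also have "\<dots> = - (\<Sum>i=1..n. \<Sum>j=1..n. pair_force (\<phi> i - \<phi> j) * d i)"
    unfolding sum_negf[symmetric]
  proof (intro sum.cong refl)
    fix i j show "pair_force (\<phi> j - \<phi> i) * d i = - (pair_force (\<phi> i - \<phi> j) * d i)"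
      using odd[of "\<phi> i - \<phi> j"] by simp
  qed
  finally have "(\<Sum>i=1..n. \<Sum>j=1..n. pair_force (\<phi> i - \<phi> j) * (d i - d j)) =
     2 * (\<Sum>i=1..n. \<Sum>j=1..n. pair_force (\<phi> i - \<phi> j) * d i)"
    by (simp add: right_diff_distrib sum_subtractf)
  then show ?thesis by (simp add: torque_def sum_distrib_left mult.commute)
qed

lemma potential_has_derivative_along:
  assumes cf: "collision_free n (\<phi> t)"
    and d: "\<And>i. i \<in> {1..n} \<Longrightarrow> ((\<lambda>s. \<phi> s i) has_real_derivative d i) (at t within S)"
  shows "((\<lambda>s. potential n (\<phi> s)) has_real_derivative (\<Sum>i=1..n. d i * torque n (\<phi> t) i)) (at t within S)"
proof -
  have pair: "((\<lambda>s. pair_potential (\<phi> s i - \<phi> s j)) has_real_derivative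
      pair_force (\<phi> t i - \<phi> t j) * (d i - d j)) (at t within S)" if ij: "i \<in> {1..n}" "j \<in> {1..n}" for i j
  proof (cases "i = j")
    case False
    then have "sin (\<phi> t i - \<phi> t j) \<noteq> 0" using cf ij by (simp add: collision_free_iff_sin)
    from DERIV_chain2[OF pair_potential_has_derivative[OF this] DERIV_diff[OF d[OF ij(1)] d[OF ij(2)]]]
    show ?thesis .
  qed simp
  have "((\<lambda>s. potential n (\<phi> s)) has_real_derivative
     (\<Sum>i=1..n. \<Sum>j=1..n. pair_force (\<phi> t i - \<phi> t j) * (d i - d j)) / 2) (at t within S)"
    unfolding potential_as_double_sum by (intro DERIV_cdivide DERIV_sum pair)
  then show ?thesis unfolding sum_pair_force_diff by simp
qed

text \<open>
  Bounding the denominator away from 0 keeps the force globally Lipschitz and changes it only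
  within distance \<open>s\<close> (measured by \<open>|sin|\<close>) of a collision.
\<close>

definition truncated_force :: "real \<Rightarrow> real \<Rightarrow> real" where
  "truncated_force s x = - sin x / (max \<bar>sin x\<bar> s) ^ 3"

lemma truncated_force_eq: "s \<le> \<bar>sin x\<bar> \<Longrightarrow> truncated_force s x = pair_force x"
  by (simp add: truncated_force_def pair_force_def max_def)

lemma truncated_force_lipschitz:
  assumes s: "s > 0"
  shows "\<exists>L. L-lipschitz_on UNIV (truncated_force s)"
proof -
  define M where "M x = max \<bar>sin x\<bar> s" for x
  have Ms: "M x \<ge> s" "M x > 0" "\<bar>sin x\<bar> \<le> M x" for x using s by (auto simp: M_def)
  have sinL: "\<bar>sin x - sin y\<bar> \<le> \<bar>x - y\<bar>" for x y :: real
  proof -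
    have "norm (sin x - sin y) \<le> 1 * norm (x - y)"
      by (rule field_differentiable_bound[of UNIV sin cos]) (auto intro!: derivative_eq_intros)
    then show ?thesis by simp
  qed
  have M_lip: "\<bar>M x - M y\<bar> \<le> \<bar>x - y\<bar>" for x y using sinL[of x y] by (auto simp: M_def)
  \<comment> \<open>The force is the product of the Lipschitz function sin and the cube of the bounded Lipschitz function q.\<close>
  define q where "q x = 1 / M x" for x
  have q: "0 \<le> q x" "q x \<le> 1 / s" for x using Ms[of x] s by (auto simp: q_def field_simps)
  have qL: "\<bar>q x - q y\<bar> \<le> \<bar>x - y\<bar> / s\<^sup>2" for x y
  proof -
    have "q x - q y = (M y - M x) * (q x * q y)"
      using Ms(2)[of x] Ms(2)[of y] by (simp add: q_def field_simps)
    then have "\<bar>q x - q y\<bar> = \<bar>M y - M x\<bar> * (q x * q y)"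
      using q(1)[of x] q(1)[of y] by (simp add: abs_mult)
    also have "\<dots> \<le> \<bar>x - y\<bar> * (1 / s * (1 / s))"
      using M_lip[of y x] q[of x] q[of y] s by (intro mult_mono) auto
    finally show ?thesis by (simp add: power2_eq_square)
  qed
  have "\<bar>truncated_force s x - truncated_force s y\<bar> \<le> (1 / s ^ 3 + 3 / s ^ 4) * \<bar>x - y\<bar>" for x y
  proof -
    have t: "truncated_force s z = - sin z * q z ^ 3" for z
      by (simp add: truncated_force_def q_def M_def power_divide)
    have cube: "\<bar>q x ^ 3 - q y ^ 3\<bar> \<le> 3 / s ^ 4 * \<bar>x - y\<bar>"
    proof -
      have "q x ^ 3 - q y ^ 3 = (q x - q y) * (q x * q x + q x * q y + q y * q y)"
        by (simp add: power3_eq_cube algebra_simps)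
      then have "\<bar>q x ^ 3 - q y ^ 3\<bar> = \<bar>q x - q y\<bar> * (q x * q x + q x * q y + q y * q y)"
        using q(1)[of x] q(1)[of y] by (simp add: abs_mult)
      also have "\<dots> \<le> (\<bar>x - y\<bar> / s\<^sup>2) * (1 / s * (1 / s) + 1 / s * (1 / s) + 1 / s * (1 / s))"
        using qL[of x y] q[of x] q[of y] s by (intro mult_mono add_mono) auto
      also have "\<dots> = 3 / s ^ 4 * \<bar>x - y\<bar>"
        using s by (simp add: power2_eq_square power4_eq_xxxx mult.assoc mult.commute)
      finally show ?thesis .
    qed
    have "truncated_force s x - truncated_force s y = (sin y - sin x) * q x ^ 3 + sin y * (q y ^ 3 - q x ^ 3)"
      unfolding t by (simp add: algebra_simps)
    also have "\<bar>\<dots>\<bar> \<le> \<bar>sin y - sin x\<bar> * \<bar>q x ^ 3\<bar> + \<bar>sin y\<bar> * \<bar>q y ^ 3 - q x ^ 3\<bar>"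
      by (metis abs_mult abs_triangle_ineq)
    also have "\<dots> \<le> \<bar>x - y\<bar> * (1 / s ^ 3) + 1 * (3 / s ^ 4 * \<bar>x - y\<bar>)"
    proof (intro add_mono mult_mono)
      show "\<bar>q x ^ 3\<bar> \<le> 1 / s ^ 3" using power_mono[OF q(2) q(1), of x 3] q(1)[of x] by (simp add: power_divide)
    qed (use sinL[of y x] cube s in \<open>auto simp: abs_minus_commute\<close>)
    finally show ?thesis by (simp add: algebra_simps)
  qed
  then have "(1 / s ^ 3 + 3 / s ^ 4)-lipschitz_on UNIV (truncated_force s)"
    using s by (intro lipschitz_onI) (auto simp: dist_real_def)
  then show ?thesis ..
qed


section \<open>The spectrum of the Hessian at the regular polygon\<close>

text \<open>
  This sum and the next one telescope after multiplication by \<open>2 sin (\<theta>/2)\<close>.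
\<close>

lemma sum_sin_arithmetic:
  fixes \<theta> :: real
  shows "2 * sin (\<theta> / 2) * (\<Sum>m=1..p. sin (real m * \<theta>)) = cos (\<theta> / 2) - cos ((real p + 1/2) * \<theta>)"
proof (induction p)
  case (Suc p)
  have "cos ((real p + 1/2) * \<theta>) - cos ((real (Suc p) + 1/2) * \<theta>) = 2 * sin (\<theta> / 2) * sin (real (Suc p) * \<theta>)"
  proof -
    have a: "(real p + 1/2) * \<theta> = real (Suc p) * \<theta> - \<theta> / 2" "(real (Suc p) + 1/2) * \<theta> = real (Suc p) * \<theta> + \<theta> / 2"
      by (simp_all add: field_simps)
    show ?thesis unfolding a cos_add cos_diff by simp
  qed
  then show ?case using Suc by (simp add: distrib_left)
qed simp

lemma sum_cos_arithmetic:
  fixes \<theta> :: real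
  shows "2 * sin (\<theta> / 2) * (\<Sum>m<n. cos (real m * \<theta>)) = sin ((real n - 1/2) * \<theta>) + sin (\<theta> / 2)"
proof (induction n)
  case (Suc p)
  have "sin ((real (Suc p) - 1/2) * \<theta>) - sin ((real p - 1/2) * \<theta>) = 2 * sin (\<theta> / 2) * cos (real p * \<theta>)"
  proof -
    have a: "(real p - 1/2) * \<theta> = real p * \<theta> - \<theta> / 2" "(real (Suc p) - 1/2) * \<theta> = real p * \<theta> + \<theta> / 2"
      by (simp_all add: field_simps)
    show ?thesis unfolding a sin_add sin_diff by simp
  qed
  then show ?case using Suc by (simp add: distrib_left)
qed simp

lemma sum_roots_of_unity_cos:
  assumes "n \<ge> 1"
  shows "(\<Sum>l<n. cos (2 * pi * real l * of_int k / real n)) = (if int n dvd k then real n else 0)"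
proof (cases "int n dvd k")
  case True
  then obtain q where q: "k = int n * q" by auto
  have "cos (2 * pi * real l * of_int k / real n) = 1" for l
  proof -
    have "2 * pi * real l * of_int k / real n = 2 * pi * of_int (int l * q)"
      using assms q by simp
    then show ?thesis by (simp only: cos_int_2pin)
  qed
  then show ?thesis using True by simp
next
  case False
  let ?\<theta> = "2 * pi * of_int k / real n"
  have "sin (?\<theta> / 2) \<noteq> 0"
  proof
    assume "sin (?\<theta> / 2) = 0"
    then obtain i :: int where "?\<theta> / 2 = of_int i * pi" by (auto simp: sin_zero_iff_int2)
    then have "real_of_int k = of_int (i * int n)" using assms by (simp add: field_simps)
    then have "k = i * int n" by (simp only: of_int_eq_iff)
    then show False using False by simp
  qed
  moreover have "sin ((real n - 1/2) * ?\<theta>) + sin (?\<theta> / 2) = 0"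
  proof -
    have e: "(real n - 1/2) * ?\<theta> = 2 * pi * of_int k - ?\<theta> / 2" using assms by (simp add: field_simps)
    show ?thesis unfolding e sin_diff by simp
  qed
  ultimately have "(\<Sum>m<n. cos (real m * ?\<theta>)) = 0"
    using sum_cos_arithmetic[of ?\<theta> n] by simp
  then show ?thesis using False by (simp add: mult_ac)
qed

text \<open>
  The squared modulus of the \<open>l\<close>-th discrete Fourier coefficient of \<open>x\<close>, written out in real terms.
\<close>

definition fourier_power :: "nat \<Rightarrow> (nat \<Rightarrow> real) \<Rightarrow> nat \<Rightarrow> real" where
  "fourier_power n x l =
     (\<Sum>i=1..n. \<Sum>j=1..n. x i * x j * cos (2 * pi * real l * (real i - real j) / real n))"

lemma fourier_power_nonneg: "fourier_power n x l \<ge> 0"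
proof -
  let ?a = "\<lambda>i. 2 * pi * real l * real i / real n"
  have "fourier_power n x l =
    (\<Sum>i=1..n. \<Sum>j=1..n. (x i * cos (?a i)) * (x j * cos (?a j)) + (x i * sin (?a i)) * (x j * sin (?a j)))"
    unfolding fourier_power_def
    by (intro sum.cong refl) (simp add: right_diff_distrib diff_divide_distrib cos_diff algebra_simps)
  also have "\<dots> = (\<Sum>i=1..n. x i * cos (?a i))\<^sup>2 + (\<Sum>i=1..n. x i * sin (?a i))\<^sup>2"
    by (simp add: sum.distrib power2_eq_square sum_product)
  finally show ?thesis by simp
qed

lemma periodic_mod:
  fixes W :: "int \<Rightarrow> real"
  assumes per: "\<And>k. W (k + int n) = W k"
  shows "W (k mod int n) = W k"
proof -
  have up: "W (k + int n * int q) = W k" for k q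
  proof (induction q)
    case (Suc q)
    have "W (k + int n * int (Suc q)) = W ((k + int n * int q) + int n)" by (simp add: algebra_simps)
    then show ?case using Suc per by simp
  qed simp
  have "W (k + int n * q) = W k" for k q
    using up[of k "nat q"] up[of "k + int n * q" "nat (- q)"]
    by (cases "q \<ge> 0") (simp_all add: algebra_simps)
  from this[of "k mod int n" "k div int n"] show ?thesis by (simp add: mult.commute)
qed

lemma sum_periodic_reflect:
  fixes W :: "int \<Rightarrow> real"
  assumes n: "n \<ge> 1" and per: "\<And>k. W (k + int n) = W k"
  shows "(\<Sum>m<n. W (k - int m)) = (\<Sum>m<n. W (int m))"
proof (rule sum.reindex_bij_witness[of _ "\<lambda>m. nat ((k - int m) mod int n)" "\<lambda>m. nat ((k - int m) mod int n)"])
  fix m assume m: "m \<in> {..<n}"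
  have i: "int (nat ((k - int m) mod int n)) = (k - int m) mod int n" using n by simp
  have "(k - (k - int m) mod int n) mod int n = int m"
    using m by (simp add: mod_diff_right_eq)
  then show "nat ((k - int (nat ((k - int m) mod int n))) mod int n) = m" unfolding i by simp
  show "nat ((k - int m) mod int n) \<in> {..<n}" using n by (simp add: nat_less_iff)
  show "W (int (nat ((k - int m) mod int n))) = W (k - int m)"
    unfolding i by (rule periodic_mod[of W n, OF per])
qed (use n in \<open>auto simp: mod_diff_right_eq nat_less_iff\<close>)

lemma sum_periodic_row:
  fixes W :: "int \<Rightarrow> real"
  assumes n: "n \<ge> 1" and per: "\<And>k. W (k + int n) = W k"
  shows "(\<Sum>j=1..n. W (int i - int j)) = (\<Sum>m<n. W (int m))"
proof -
  have "(\<Sum>j=1..n. W (int i - int j)) = (\<Sum>m<n. W ((int i - 1) - int m))"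
    by (rule sum.reindex_bij_witness[of _ Suc "\<lambda>j. j - 1"]) (auto simp: algebra_simps of_nat_diff)
  then show ?thesis using sum_periodic_reflect[of n W, OF n per] by simp
qed

text \<open>
  The discrete Fourier transform diagonalises circulant forms: expand the Fourier powers and sum
  over the frequencies first, where orthogonality of the characters leaves only the diagonal
  \<open>i = j\<close> and the terms with \<open>m\<close> congruent to \<open>i - j\<close> or \<open>j - i\<close> modulo \<open>n\<close>. The case of constant weights is Parseval's identity.
\<close>

lemma circulant_form_fourier:
  fixes W :: "int \<Rightarrow> real" and x :: "nat \<Rightarrow> real"
  assumes n: "n \<ge> 1" and per: "\<And>k. W (k + int n) = W k" and even: "\<And>k. W (- k) = W k"
  shows "real n * (\<Sum>i=1..n. \<Sum>j=1..n. W (int i - int j) * (x i - x j)\<^sup>2) =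
    2 * (\<Sum>l<n. (\<Sum>m<n. W (int m) * (1 - cos (2 * pi * real l * real m / real n))) * fourier_power n x l)"
proof -
  let ?\<delta> = "\<lambda>k::int. if int n dvd k then 1 else 0 :: real"
  have orth: "(\<Sum>l<n. cos (2 * pi * real l * of_int k / real n)) = real n * ?\<delta> k" for k
    using sum_roots_of_unity_cos[OF n, of k] by simp
  note Wmod = periodic_mod[of W n, OF per]
  have sel: "(\<Sum>m<n. W (int m) * ?\<delta> (k - int m)) = W k" for k
  proof -
    let ?m = "nat (k mod int n)"
    have m: "?m < n" "int ?m = k mod int n" using n by (auto simp: nat_less_iff)
    have "int n dvd (k - int m) \<longleftrightarrow> m = ?m" if "m < n" for m
    proof -
      have "int n dvd (k - int m) \<longleftrightarrow> k mod int n = int m mod int n" by (simp add: mod_eq_dvd_iff)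
      also have "int m mod int n = int m" using that by simp
      finally show ?thesis using m by auto
    qed
    then have "(\<Sum>m<n. W (int m) * ?\<delta> (k - int m)) = (\<Sum>m<n. if m = ?m then W (int m) else 0)"
      by (intro sum.cong refl) auto
    also have "\<dots> = W (k mod int n)" using m by (simp add: sum.delta)
    finally show ?thesis using Wmod by simp
  qed
  define S where "S = (\<Sum>m<n. W (int m))"
  have key: "(\<Sum>l<n. (\<Sum>m<n. W (int m) * (1 - cos (2 * pi * real l * real m / real n))) *
        cos (2 * pi * real l * of_int k / real n)) = real n * (?\<delta> k * S - W k)" for k :: int
  proof -
    have pt: "(1 - cos (2 * pi * real l * real m / real n)) * cos (2 * pi * real l * of_int k / real n)
      = cos (2 * pi * real l * of_int k / real n)
        - (cos (2 * pi * real l * of_int (k - int m) / real n) + cos (2 * pi * real l * of_int (k + int m) / real n)) / 2"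
      for l m
      by (simp add: distrib_left right_diff_distrib add_divide_distrib diff_divide_distrib cos_add cos_diff algebra_simps)
    have "(\<Sum>l<n. (\<Sum>m<n. W (int m) * (1 - cos (2 * pi * real l * real m / real n))) *
        cos (2 * pi * real l * of_int k / real n)) =
      (\<Sum>m<n. W (int m) * (\<Sum>l<n. (1 - cos (2 * pi * real l * real m / real n)) * cos (2 * pi * real l * of_int k / real n)))"
      by (simp add: sum_distrib_left sum_distrib_right mult.assoc) (rule sum.swap)
    also have "\<dots> = (\<Sum>m<n. W (int m) * (real n * ?\<delta> k - (real n * ?\<delta> (k - int m) + real n * ?\<delta> (k + int m)) / 2))"
      unfolding pt sum_subtractf sum.distrib sum_divide_distrib[symmetric] orth ..
    also have "\<dots> = (\<Sum>m<n. real n * (W (int m) * ?\<delta> k -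
        (W (int m) * ?\<delta> (k - int m) + W (int m) * ?\<delta> (k + int m)) / 2))"
    proof -
      have "w * (N * a - (N * b + N * c) / 2) = N * (w * a - (w * b + w * c) / 2)" for w N a b c :: real
        by (simp add: field_simps)
      then show ?thesis by (intro sum.cong refl)
    qed
    also have "\<dots> = real n * (S * ?\<delta> k -
        ((\<Sum>m<n. W (int m) * ?\<delta> (k - int m)) + (\<Sum>m<n. W (int m) * ?\<delta> (k + int m))) / 2)"
      by (simp only: sum_distrib_left[symmetric] sum_subtractf sum.distrib
          sum_divide_distrib[symmetric] sum_distrib_right[symmetric] S_def)
    also have "(\<Sum>m<n. W (int m) * ?\<delta> (k + int m)) = W k"
    proof -
      have "int n dvd (k + int m) \<longleftrightarrow> int n dvd (- k - int m)" for m
        using dvd_minus_iff[of "int n" "k + int m"] by simp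
      then show ?thesis using sel[of "- k"] even by simp
    qed
    also have "(\<Sum>m<n. W (int m) * ?\<delta> (k - int m)) = W k" by (rule sel)
    finally show ?thesis by (simp add: mult.commute)
  qed
  have "(\<Sum>l<n. (\<Sum>m<n. W (int m) * (1 - cos (2 * pi * real l * real m / real n))) * fourier_power n x l) =
    (\<Sum>i=1..n. \<Sum>j=1..n. x i * x j * (\<Sum>l<n. (\<Sum>m<n. W (int m) * (1 - cos (2 * pi * real l * real m / real n))) *
        cos (2 * pi * real l * of_int (int i - int j) / real n)))"
  proof -
    have sw: "(\<Sum>l<n. \<Sum>i=1..n. \<Sum>j=1..n. h l i j) = (\<Sum>i=1..n. \<Sum>j=1..n. \<Sum>l<n. h l i j)" for h :: "nat \<Rightarrow> nat \<Rightarrow> nat \<Rightarrow> real"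
      by (subst sum.swap) (intro sum.cong refl sum.swap)
    show ?thesis
      unfolding fourier_power_def sum_distrib_left[of _ _ "{1..n}"] sw
      unfolding sum_distrib_left
      by (intro sum.cong refl) (simp add: mult_ac)
  qed
  also have "\<dots> = (\<Sum>i=1..n. \<Sum>j=1..n. x i * x j * (real n * (?\<delta> (int i - int j) * S - W (int i - int j))))"
    unfolding key ..
  also have "\<dots> = real n * (S * (\<Sum>i=1..n. (x i)\<^sup>2) - (\<Sum>i=1..n. \<Sum>j=1..n. W (int i - int j) * x i * x j))"
  proof -
    have "int n dvd (int i - int j) \<longleftrightarrow> i = j" if "i \<in> {1..n}" "j \<in> {1..n}" for i j
    proof
      assume "int n dvd (int i - int j)"
      moreover have "\<bar>int i - int j\<bar> < int n" using that by auto
      ultimately have "int i - int j = 0" using dvd_imp_le_int[of "int i - int j" "int n"] by linarith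
      then show "i = j" by simp
    qed simp
    then have "(\<Sum>i=1..n. \<Sum>j=1..n. x i * x j * (real n * (?\<delta> (int i - int j) * S - W (int i - int j)))) =
      (\<Sum>i=1..n. \<Sum>j=1..n. (if i = j then real n * S * (x i)\<^sup>2 else 0) - real n * (W (int i - int j) * x i * x j))"
      by (intro sum.cong refl) (auto simp: power2_eq_square algebra_simps)
    also have "\<dots> = real n * (S * (\<Sum>i=1..n. (x i)\<^sup>2) - (\<Sum>i=1..n. \<Sum>j=1..n. W (int i - int j) * x i * x j))"
      by (simp add: sum_subtractf sum.delta sum_distrib_left right_diff_distrib mult.assoc)
    finally show ?thesis .
  qed
  also have "2 * \<dots> = real n * (\<Sum>i=1..n. \<Sum>j=1..n. W (int i - int j) * (x i - x j)\<^sup>2)"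
  proof -
    have row: "(\<Sum>j=1..n. W (int i - int j)) = S" for i
      unfolding S_def by (rule sum_periodic_row[of n W, OF n per])
    have "(\<Sum>i=1..n. \<Sum>j=1..n. W (int i - int j) * (x i - x j)\<^sup>2) =
      (\<Sum>i=1..n. \<Sum>j=1..n. W (int i - int j) * (x i)\<^sup>2) + (\<Sum>i=1..n. \<Sum>j=1..n. W (int i - int j) * (x j)\<^sup>2)
      - 2 * (\<Sum>i=1..n. \<Sum>j=1..n. W (int i - int j) * x i * x j)"
      by (simp add: power2_diff algebra_simps sum.distrib sum_subtractf sum_distrib_left)
    also have "(\<Sum>i=1..n. \<Sum>j=1..n. W (int i - int j) * (x j)\<^sup>2) = (\<Sum>i=1..n. \<Sum>j=1..n. W (int i - int j) * (x i)\<^sup>2)"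
    proof (subst sum.swap, intro sum.cong refl)
      fix i j show "W (int j - int i) * (x i)\<^sup>2 = W (int i - int j) * (x i)\<^sup>2"
        using even[of "int i - int j"] by simp
    qed
    also have "(\<Sum>i=1..n. \<Sum>j=1..n. W (int i - int j) * (x i)\<^sup>2) = S * (\<Sum>i=1..n. (x i)\<^sup>2)"
      unfolding sum_distrib_right[symmetric] row sum_distrib_left ..
    finally have square: "(\<Sum>i=1..n. \<Sum>j=1..n. W (int i - int j) * (x i - x j)\<^sup>2) =
      S * (\<Sum>i=1..n. (x i)\<^sup>2) + S * (\<Sum>i=1..n. (x i)\<^sup>2) -
      2 * (\<Sum>i=1..n. \<Sum>j=1..n. W (int i - int j) * x i * x j)" .
    show ?thesis unfolding square by (simp add: algebra_simps)
  qed
  finally show ?thesis by simp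
qed

text \<open>
  Up to a positive constant factor, the eigenvalue of the Hessian at the frequency \<open>2 r\<close>. The term
  \<open>m = 0\<close> vanishes as a division by 0.
\<close>

definition polygon_mode :: "nat \<Rightarrow> int \<Rightarrow> real" where
  "polygon_mode n r = (\<Sum>m<n. cos (2 * pi * real m / real n) / \<bar>sin (2 * pi * real m / real n)\<bar> ^ 3 *
     (sin (of_int r * (2 * pi * real m / real n)))\<^sup>2)"

text \<open>
  Half the second difference of \<open>polygon_mode\<close> with respect to \<open>r\<close>.
\<close>

definition mode_curvature :: "nat \<Rightarrow> int \<Rightarrow> real" where
  "mode_curvature n r = (\<Sum>m<n. cos (2 * pi * real m / real n) / \<bar>sin (2 * pi * real m / real n)\<bar> *
     cos (2 * of_int r * (2 * pi * real m / real n)))"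

text \<open>
  The second difference of \<open>sin\<^sup>2 (r x)\<close> in \<open>r\<close> is \<open>2 sin\<^sup>2 x cos (2 r x)\<close>; its factor \<open>sin\<^sup>2 x\<close> lowers the
  order of the singularity from 3 to 1.
\<close>

lemma polygon_mode_second_difference:
  "polygon_mode n (r + 1) - 2 * polygon_mode n r + polygon_mode n (r - 1) = 2 * mode_curvature n r"
proof -
  have sq: "(sin ((R + 1) * x))\<^sup>2 - 2 * (sin (R * x))\<^sup>2 + (sin ((R - 1) * x))\<^sup>2 =
      2 * (sin x)\<^sup>2 * cos (2 * R * x)" for R x :: real
  proof -
    have half: "(sin y)\<^sup>2 = (1 - cos (2 * y)) / 2" for y :: real
      using cos_double_sin[of y] by simp
    have "cos (2 * ((R + 1) * x)) + cos (2 * ((R - 1) * x)) = 2 * cos (2 * x) * cos (2 * R * x)"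
    proof -
      have e: "2 * ((R + 1) * x) = 2 * R * x + 2 * x" "2 * ((R - 1) * x) = 2 * R * x - 2 * x"
        by (simp_all add: algebra_simps)
      show ?thesis unfolding e cos_add cos_diff by simp
    qed
    moreover have "(1 - c1) / 2 - (1 - d) + (1 - c2) / 2 = (1 - c) * d"
      if "c1 + c2 = 2 * c * d" for c1 c2 c d :: real
      using that by (simp add: field_simps)
    ultimately have "(1 - cos (2 * ((R + 1) * x))) / 2 - (1 - cos (2 * R * x)) + (1 - cos (2 * ((R - 1) * x))) / 2
        = (1 - cos (2 * x)) * cos (2 * R * x)"
      by blast
    then show ?thesis unfolding half[of "(R+1)*x"] half[of "(R-1)*x"] half[of x] half[of "R*x"]
      by (simp add: mult.assoc[of 2 R x] diff_divide_distrib left_diff_distrib[of _ "2 * cos (2 * x)"] left_diff_distrib[of 1])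
  qed
  have "polygon_mode n (r + 1) - 2 * polygon_mode n r + polygon_mode n (r - 1) =
    (\<Sum>m<n. cos (2 * pi * real m / real n) / \<bar>sin (2 * pi * real m / real n)\<bar> ^ 3 *
      ((sin ((of_int r + 1) * (2 * pi * real m / real n)))\<^sup>2 - 2 * (sin (of_int r * (2 * pi * real m / real n)))\<^sup>2
       + (sin ((of_int r - 1) * (2 * pi * real m / real n)))\<^sup>2))"
    unfolding polygon_mode_def sum_distrib_left sum_subtractf[symmetric] sum.distrib[symmetric]
    by (intro sum.cong refl) (simp add: algebra_simps)
  also have "\<dots> = 2 * mode_curvature n r"
    unfolding sq mode_curvature_def sum_distrib_left
  proof (intro sum.cong refl)
    fix m
    let ?x = "2 * pi * real m / real n"
    have "a / \<bar>s\<bar> ^ 3 * (2 * s\<^sup>2 * c) = 2 * (a / \<bar>s\<bar> * c)" for a s c :: real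
    proof (cases "s = 0")
      case False
      have "s\<^sup>2 = \<bar>s\<bar>\<^sup>2" by simp
      with False show ?thesis by (simp add: power2_eq_square power3_eq_cube field_simps)
    qed simp
    then show "cos ?x / \<bar>sin ?x\<bar> ^ 3 * (2 * (sin ?x)\<^sup>2 * cos (2 * of_int r * ?x)) =
        2 * (cos ?x / \<bar>sin ?x\<bar> * cos (2 * of_int r * ?x))" .
  qed
  finally show ?thesis .
qed

lemma polygon_mode_minus: "polygon_mode n (- r) = polygon_mode n r"
  by (simp add: polygon_mode_def)

lemma polygon_mode_0: "polygon_mode n 0 = 0"
  by (simp add: polygon_mode_def)

lemma polygon_mode_periodic:
  assumes "n \<ge> 1" shows "polygon_mode n (r + int n) = polygon_mode n r"
  unfolding polygon_mode_def
proof (intro sum.cong refl)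
  fix m
  have e: "of_int (r + int n) * (2 * pi * real m / real n) = of_int r * (2 * pi * real m / real n) + 2 * pi * real m"
    using assms by (simp add: field_simps)
  have "sin (2 * pi * real m) = 0" "cos (2 * pi * real m) = 1"
    using sin_int_2pin[of "int m"] cos_int_2pin[of "int m"] by simp_all
  then show "cos (2 * pi * real m / real n) / \<bar>sin (2 * pi * real m / real n)\<bar> ^ 3 *
          (sin (of_int (r + int n) * (2 * pi * real m / real n)))\<^sup>2 =
         cos (2 * pi * real m / real n) / \<bar>sin (2 * pi * real m / real n)\<bar> ^ 3 *
          (sin (of_int r * (2 * pi * real m / real n)))\<^sup>2"
    unfolding e sin_add by simp
qed

text \<open>
  For odd \<open>n\<close> the reflection \<open>x \<mapsto> 2 \<pi> - x\<close> pairs the vertices other than the one at 0, and the half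
  that remains lies in the open upper half circle, where \<open>|sin x| = sin x\<close>.
\<close>

lemma sum_polygon_fold:
  fixes h :: "real \<Rightarrow> real"
  assumes n: "n = 2 * p + 1" and h: "h 0 = 0" "\<And>x. h (2 * pi - x) = h x"
  shows "(\<Sum>m<n. h (2 * pi * real m / real n)) = 2 * (\<Sum>m=1..p. h (2 * pi * real m / real n))"
proof -
  let ?g = "\<lambda>m. h (2 * pi * real m / real n)"
  have split: "{..<n} = {0} \<union> {1..p} \<union> {p+1..2*p}" using n by auto
  have "(\<Sum>m<n. ?g m) = (\<Sum>m=1..p. ?g m) + (\<Sum>m=p+1..2*p. ?g m)"
    unfolding split by (subst sum.union_disjoint, simp, simp, force)+ (simp add: h)
  also have "(\<Sum>m=p+1..2*p. ?g m) = (\<Sum>m=1..p. ?g m)"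
  proof (rule sum.reindex_bij_witness[of _ "\<lambda>m. n - m" "\<lambda>m. n - m"])
    fix m assume "m \<in> {p+1..2*p}"
    then have "2 * pi * real (n - m) / real n = 2 * pi - 2 * pi * real m / real n"
      using n by (simp add: of_nat_diff field_simps)
    then show "?g (n - m) = ?g m" using h(2)[of "2 * pi * real m / real n"] by (simp only:)
  qed (use n in auto)
  finally show ?thesis by simp
qed

lemma polygon_angle_bounds:
  assumes "n = 2 * p + 1" "m \<in> {1..p}"
  shows "0 < 2 * pi * real m / real n" "2 * pi * real m / real n < pi"
proof -
  show "0 < 2 * pi * real m / real n" using assms by simp
  have "2 * real m < real n" using assms by auto
  then have "pi * (2 * real m) < pi * real n" by simp
  then show "2 * pi * real m / real n < pi" using assms by (simp add: divide_less_eq mult_ac)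
qed

lemma mode_curvature_fold:
  assumes "n = 2 * p + 1"
  shows "mode_curvature n r = 2 * (\<Sum>m=1..p. cos (2 * pi * real m / real n) / sin (2 * pi * real m / real n) *
     cos (2 * of_int r * (2 * pi * real m / real n)))"
proof -
  let ?h = "\<lambda>x. cos x / \<bar>sin x\<bar> * cos (2 * of_int r * x)"
  have "?h (2 * pi - x) = ?h x" for x
  proof -
    have e: "2 * of_int r * (2 * pi - x) = 2 * pi * of_int (2 * r) - 2 * of_int r * x"
      by (simp add: algebra_simps)
    have "cos (2 * of_int r * (2 * pi - x)) = cos (2 * of_int r * x)"
      unfolding e cos_diff cos_int_2pin sin_int_2pin by simp
    then show ?thesis by (simp add: cos_diff sin_diff)
  qed
  then have "mode_curvature n r = 2 * (\<Sum>m=1..p. ?h (2 * pi * real m / real n))"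
    unfolding mode_curvature_def by (rule sum_polygon_fold[OF assms, rotated]) simp
  moreover have "\<bar>sin (2 * pi * real m / real n)\<bar> = sin (2 * pi * real m / real n)" if "m \<in> {1..p}" for m
  proof -
    have "sin (2 * pi * real m / real n) > 0"
      using polygon_angle_bounds[OF assms that] by (rule sin_gt_zero)
    then show ?thesis by simp
  qed
  ultimately show ?thesis by simp
qed

text \<open>
  The difference \<open>cos ((2 r + 2) x) - cos (2 r x)\<close> contains the factor \<open>sin x\<close>, which removes the
  denominator. What remains are sums of sines over \<open>m = 1, ..., p\<close>, and they equal
  \<open>- tan (\<pi> k / n) / 2\<close>; only their sign is needed, and it follows from the telescoped form.
\<close>

lemma mode_curvature_strict_increase:
  assumes n: "n = 2 * p + 1" and r: "0 \<le> r" "r < int p"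
  shows "mode_curvature n r < mode_curvature n (r + 1)"
proof -
  let ?x = "\<lambda>m. 2 * pi * real m / real n"
  let ?S = "\<lambda>k. (\<Sum>m=1..p. sin (2 * of_int k * ?x m))"
  \<comment> \<open>The sign of the half-circle sine sum at frequency 2k, for k from 0 to p.\<close>
  have tan: "?S k \<le> 0 \<and> (k > 0 \<longrightarrow> ?S k < 0)" if k: "0 \<le> k" "k \<le> int p" for k :: int
  proof (cases "k = 0")
    case False
    let ?t = "4 * pi * of_int k / real n"
    have half: "0 < ?t / 2" "?t / 2 < pi"
    proof -
      show "0 < ?t / 2" using False k n by simp
      have "2 * real_of_int k < real n" using k n by linarith
      then have "pi * (2 * real_of_int k) < pi * real n" by simp
      then show "?t / 2 < pi" using n by (simp add: divide_less_eq mult_ac)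
    qed
    have e: "(real p + 1/2) * ?t = 2 * pi * of_int k" using n by (simp add: field_simps)
    have "2 * sin (?t / 2) * (\<Sum>m=1..p. sin (real m * ?t)) = cos (?t / 2) - 1"
      using sum_sin_arithmetic[of ?t p] unfolding e cos_int_2pin .
    moreover have "cos (?t / 2) < 1"
      using half cos_monotone_0_pi[of 0 "?t / 2"] by simp
    moreover have "sin (?t / 2) > 0" using half by (rule sin_gt_zero)
    ultimately have "(\<Sum>m=1..p. sin (real m * ?t)) < 0"
      by (smt (verit) mult_nonneg_nonneg)
    then show ?thesis by (simp add: mult_ac)
  qed simp
  have "mode_curvature n (r + 1) - mode_curvature n r =
     2 * (\<Sum>m=1..p. cos (?x m) / sin (?x m) * (cos (2 * of_int (r + 1) * ?x m) - cos (2 * of_int r * ?x m)))"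
    unfolding mode_curvature_fold[OF n] by (simp add: sum_subtractf right_diff_distrib)
  also have "\<dots> = 2 * (\<Sum>m=1..p. - (sin (2 * of_int (r + 1) * ?x m) + sin (2 * of_int r * ?x m)))"
  proof (intro arg_cong[where f = "\<lambda>s. 2 * s"] sum.cong refl)
    fix m assume "m \<in> {1..p}"
    then have s: "sin (?x m) > 0" using polygon_angle_bounds[OF n] by (intro sin_gt_zero)
    have shift: "cos x * (cos (y + x) - cos (y - x)) = - sin x * (sin (y + x) + sin (y - x))" for x y :: real
      unfolding cos_add cos_diff sin_add sin_diff by (simp add: algebra_simps)
    have "cos x * (cos (2 * (R + 1) * x) - cos (2 * R * x)) =
        - sin x * (sin (2 * (R + 1) * x) + sin (2 * R * x))" for x R :: real
      using shift[of x "2 * R * x + x"] by (simp add: algebra_simps)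
    from this[of "?x m" "of_int r"]
    have "cos (?x m) * (cos (2 * of_int (r + 1) * ?x m) - cos (2 * of_int r * ?x m)) =
        - sin (?x m) * (sin (2 * of_int (r + 1) * ?x m) + sin (2 * of_int r * ?x m))"
      by simp
    with s show "cos (?x m) / sin (?x m) * (cos (2 * of_int (r + 1) * ?x m) - cos (2 * of_int r * ?x m)) =
       - (sin (2 * of_int (r + 1) * ?x m) + sin (2 * of_int r * ?x m))"
      by (simp add: field_simps)
  qed
  also have "\<dots> = - 2 * (?S (r + 1) + ?S r)" by (simp add: sum_negf sum.distrib sum_subtractf)
  also have "\<dots> > 0" using tan[of "r + 1"] tan[of r] r by simp
  finally show ?thesis by simp
qed

text \<open>
  The angles with indices \<open>m\<close> and \<open>p + 1 - m\<close> add up to \<open>\<pi> + \<pi> / n\<close>, slightly more than \<open>\<pi>\<close>, so their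
  cotangents \<open>cot a + cot b = sin (a + b) / (sin a sin b)\<close> have a negative sum.
\<close>

lemma mode_curvature_0_neg:
  assumes n: "n = 2 * p + 1" and p: "p \<ge> 1"
  shows "mode_curvature n 0 < 0"
proof -
  let ?c = "\<lambda>m. cos (2 * pi * real m / real n) / sin (2 * pi * real m / real n)"
  have pair: "?c m + ?c (p + 1 - m) < 0" if m: "m \<in> {1..p}" for m
  proof -
    let ?a = "2 * pi * real m / real n" and ?b = "2 * pi * real (p + 1 - m) / real n"
    have m': "p + 1 - m \<in> {1..p}" using m by auto
    have s: "sin ?a > 0" "sin ?b > 0"
      by (rule sin_gt_zero[OF polygon_angle_bounds[OF n m]], rule sin_gt_zero[OF polygon_angle_bounds[OF n m']])
    have "?a + ?b = pi * (real n + 1) / real n"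
      using m n by (simp add: of_nat_diff algebra_simps flip: add_divide_distrib)
    moreover have "real n > 0" using n by simp
    ultimately have ab: "?a + ?b = pi + pi / real n" by (simp add: field_simps)
    have "sin (?a + ?b) = - sin (pi / real n)" unfolding ab by simp
    moreover have "sin (pi / real n) > 0" using n p by (intro sin_gt_zero) (auto simp: field_simps)
    ultimately have "sin (?a + ?b) / (sin ?a * sin ?b) < 0" using s by (simp add: field_simps)
    moreover have "?c m + ?c (p + 1 - m) = sin (?a + ?b) / (sin ?a * sin ?b)"
      unfolding sin_add using s by (simp add: field_simps)
    ultimately show ?thesis by simp
  qed
  have "(\<Sum>m=1..p. ?c (p + 1 - m)) = (\<Sum>m=1..p. ?c m)"
    by (rule sum.reindex_bij_witness[of _ "\<lambda>m. p + 1 - m" "\<lambda>m. p + 1 - m"]) auto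
  then have "2 * (\<Sum>m=1..p. ?c m) = (\<Sum>m=1..p. ?c m + ?c (p + 1 - m))"
    by (simp add: sum.distrib)
  also have "\<dots> < 0"
    using sum_strict_mono[of "{1..p}" "\<lambda>m. ?c m + ?c (p + 1 - m)" "\<lambda>_. 0"] pair p by simp
  finally show ?thesis unfolding mode_curvature_fold[OF n] by simp
qed

text \<open>
  The first difference \<open>D\<close> has increments \<open>2 C\<close> with \<open>C\<close> increasing, and \<open>D 0 < 0 = D p\<close>. If \<open>D\<close> became
  nonnegative before \<open>p\<close>, then \<open>C\<close> would be positive from there on, and \<open>D p\<close> could not be 0.
\<close>

lemma polygon_mode_neg:
  assumes n: "n = 2 * p + 1" and p: "p \<ge> 1" and r: "1 \<le> r" "r \<le> p"
  shows "polygon_mode n (int r) < 0"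
proof -
  define D where "D r = polygon_mode n (int r + 1) - polygon_mode n (int r)" for r
  define C where "C r = mode_curvature n (int r)" for r
  have DC: "D (Suc r) = D r + 2 * C (Suc r)" for r
    using polygon_mode_second_difference[of n "int r + 1"] by (simp add: D_def C_def algebra_simps)
  have C_mono: "C r < C (Suc r)" if "r < p" for r
    using mode_curvature_strict_increase[OF n, of "int r"] that by (simp add: C_def add.commute)
  have C_less: "C r \<le> C s" if "r \<le> s" "s \<le> p" for r s
    using that(1,2) by (induction s rule: dec_induct) (use C_mono in \<open>force simp: Suc_le_eq\<close>)+
  \<comment> \<open>The two middle modes p and p + 1 = n - p coincide.\<close>
  have Dp: "D p = 0"
  proof -
    have "int p = - (int p + 1) + int n" using n by simp
    then have "polygon_mode n (int p) = polygon_mode n (- (int p + 1))"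
      using polygon_mode_periodic[of n "- (int p + 1)"] n by simp
    then show ?thesis by (simp only: D_def polygon_mode_minus)
  qed
  have "D 0 = C 0"
    using polygon_mode_second_difference[of n 0] polygon_mode_minus[of n 1]
    by (simp add: D_def C_def polygon_mode_0)
  then have D0: "D 0 < 0" using mode_curvature_0_neg[OF n p] by (simp add: C_def)
  have Dneg: "D r < 0" if "r < p" for r
    using that
  proof (induction r)
    case (Suc r)
    show ?case
    proof (rule ccontr)
      assume ge: "\<not> D (Suc r) < 0"
      then have Cpos: "C (Suc r) > 0" using DC[of r] Suc by simp
      have "D s \<ge> 0 \<and> (s > Suc r \<longrightarrow> D s > 0)" if "Suc r \<le> s" "s \<le> p" for s
        using that
      proof (induction s rule: dec_induct)
        case base then show ?case using ge by simp
      next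
        case (step s)
        have "C (Suc s) > 0" using C_less[of "Suc r" "Suc s"] step Cpos by simp
        then show ?case using DC[of s] step by simp
      qed
      from this[of p] Dp Suc.prems show False by simp
    qed
  qed (use D0 in simp)
  have "polygon_mode n (int r) < 0 \<or> r = 0" if "r \<le> p" for r
    using that
  proof (induction r)
    case (Suc r)
    then show ?case using Dneg[of r] by (auto simp: D_def polygon_mode_0 add.commute)
  qed simp
  then show ?thesis using r by fastforce
qed

text \<open>
  Since \<open>n\<close> is odd, either \<open>l\<close> or \<open>n - l\<close> is even, and both give the same value of the cosine.
\<close>

lemma polygon_frequency_neg:
  assumes n: "n = 2 * p + 1" and l: "1 \<le> l" "l < n"
  shows "(\<Sum>m<n. cos (2 * pi * real m / real n) / \<bar>sin (2 * pi * real m / real n)\<bar> ^ 3 *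
     (1 - cos (2 * pi * real l * real m / real n))) < 0"
proof -
  have p: "p \<ge> 1" using n l by simp
  define r where "r = (if even l then l div 2 else (n - l) div 2)"
  have r: "1 \<le> r" "r \<le> p" "l = 2 * r \<or> l = n - 2 * r \<and> 2 * r \<le> n"
    using n l by (auto simp: r_def elim!: evenE oddE)
  have "1 - cos (2 * pi * real l * real m / real n) = 2 * (sin (of_int (int r) * (2 * pi * real m / real n)))\<^sup>2" for m
  proof -
    let ?y = "of_int (int r) * (2 * pi * real m / real n)"
    have n0: "real n > 0" using n by simp
    have "cos (2 * pi * real l * real m / real n) = cos (2 * ?y)"
    proof (cases "l = 2 * r")
      case True
      then show ?thesis by (simp add: mult_ac)
    next
      case False
      then have l': "real l = real n - 2 * real r" using r(3) by (auto simp: of_nat_diff)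
      have e: "2 * pi * real l * real m / real n = 2 * pi * of_int (int m) - 2 * ?y"
        unfolding l' using n0 by (simp add: field_simps)
      show ?thesis unfolding e cos_diff cos_int_2pin sin_int_2pin by simp
    qed
    then show ?thesis using cos_double_sin[of ?y] by simp
  qed
  then have "(\<Sum>m<n. cos (2 * pi * real m / real n) / \<bar>sin (2 * pi * real m / real n)\<bar> ^ 3 *
     (1 - cos (2 * pi * real l * real m / real n))) = 2 * polygon_mode n (int r)"
    unfolding polygon_mode_def sum_distrib_left by (intro sum.cong refl) simp
  then show ?thesis using polygon_mode_neg[OF n p r(1,2)] by simp
qed

lemma periodic_function_at_polygon:
  fixes h :: "real \<Rightarrow> real"
  assumes "n \<ge> 1" "\<And>x. h (x + 2 * pi) = h x"
  shows "h (2 * pi * of_int (k + int n) / real n) = h (2 * pi * of_int k / real n)"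
proof -
  have "2 * pi * of_int (k + int n) / real n = 2 * pi * of_int k / real n + 2 * pi"
    using assms(1) by (simp add: field_simps)
  then show ?thesis using assms(2) by simp
qed

text \<open>
  Comparison of two circulant forms frequency by frequency: the Hessian and the sum of all squared
  differences, which has the same value \<open>n\<close> at all nonzero frequencies. The frequency 0 corresponds to
  rotations of the whole polygon and is invisible to both.
\<close>

lemma polygon_hessian_negative_definite:
  assumes n: "n = 2 * p + 1" and p: "p \<ge> 1"
  shows "\<exists>c>0. \<forall>x. (\<Sum>i=1..n. \<Sum>j=1..n.
      cos (2 * pi * of_int (int i - int j) / real n) / \<bar>sin (2 * pi * of_int (int i - int j) / real n)\<bar> ^ 3 * (x i - x j)\<^sup>2)
    \<le> - c * (\<Sum>i=1..n. \<Sum>j=1..n. (x i - x j)\<^sup>2)"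
proof -
  have n1: "n \<ge> 1" "real n > 0" using n by auto
  define W :: "int \<Rightarrow> real" where
    "W k = cos (2 * pi * of_int k / real n) / \<bar>sin (2 * pi * of_int k / real n)\<bar> ^ 3" for k
  have Wper: "W (k + int n) = W k" for k
    using periodic_function_at_polygon[of n "\<lambda>x. cos x / \<bar>sin x\<bar> ^ 3" k] n1 by (simp add: W_def)
  have Weven: "W (- k) = W k" for k by (simp add: W_def)
  define \<mu> where "\<mu> l = (\<Sum>m<n. W (int m) * (1 - cos (2 * pi * real l * real m / real n)))" for l
  have neg: "\<mu> l < 0" if "1 \<le> l" "l < n" for l
    using polygon_frequency_neg[OF n that] by (simp add: \<mu>_def W_def)
  have \<mu>0: "\<mu> 0 = 0" by (simp add: \<mu>_def)
  define c where "c = Min ((\<lambda>l. - \<mu> l) ` {1..<n}) / real n"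
  have ne: "{1..<n} \<noteq> {}" using n p by auto
  have c: "c > 0" using neg n1 ne by (auto simp: c_def)
  have \<mu>_le: "\<mu> l \<le> - c * real n" if "1 \<le> l" "l < n" for l
  proof -
    have "c * real n \<le> - \<mu> l" using that n1 by (auto simp: c_def intro!: Min_le)
    then show ?thesis by simp
  qed
  have "(\<Sum>i=1..n. \<Sum>j=1..n. W (int i - int j) * (x i - x j)\<^sup>2) \<le>
      - c * (\<Sum>i=1..n. \<Sum>j=1..n. (x i - x j)\<^sup>2)" for x :: "nat \<Rightarrow> real"
  proof -
    have flat: "(\<Sum>m<n. 1 - cos (2 * pi * real l * real m / real n)) = (if l = 0 then 0 else real n)"
      if "l < n" for l
    proof -
      have "(\<Sum>m<n. cos (2 * pi * real l * real m / real n)) = (if int n dvd int l then real n else 0)"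
        using sum_roots_of_unity_cos[OF n1(1), of "int l"] by (simp add: mult_ac)
      moreover have "int n dvd int l \<longleftrightarrow> l = 0" using that by (auto dest: dvd_imp_le)
      ultimately show ?thesis by (simp add: sum_subtractf)
    qed
    have "real n * (\<Sum>i=1..n. \<Sum>j=1..n. W (int i - int j) * (x i - x j)\<^sup>2) = 2 * (\<Sum>l<n. \<mu> l * fourier_power n x l)"
      unfolding \<mu>_def by (rule circulant_form_fourier[OF n1(1) Wper Weven])
    also have "\<dots> \<le> 2 * (\<Sum>l<n. (- c * (if l = 0 then 0 else real n)) * fourier_power n x l)"
    proof (intro mult_left_mono sum_mono mult_right_mono fourier_power_nonneg)
      fix l assume "l \<in> {..<n}"
      then show "\<mu> l \<le> - c * (if l = 0 then 0 else real n)" using \<mu>0 \<mu>_le[of l] by auto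
    qed simp
    also have "\<dots> = - c * (2 * (\<Sum>l<n. (\<Sum>m<n. 1 * (1 - cos (2 * pi * real l * real m / real n))) * fourier_power n x l))"
      unfolding sum_distrib_left using flat by (intro sum.cong refl) simp
    also have "2 * (\<Sum>l<n. (\<Sum>m<n. 1 * (1 - cos (2 * pi * real l * real m / real n))) * fourier_power n x l) =
        real n * (\<Sum>i=1..n. \<Sum>j=1..n. 1 * (x i - x j)\<^sup>2)"
      using circulant_form_fourier[of n "\<lambda>_. 1" x] n1 by simp
    finally have "real n * (\<Sum>i=1..n. \<Sum>j=1..n. W (int i - int j) * (x i - x j)\<^sup>2) \<le>
        real n * (- c * (\<Sum>i=1..n. \<Sum>j=1..n. (x i - x j)\<^sup>2))" by (simp add: mult_ac)
    then show ?thesis using n1(2) mult_le_cancel_left_pos by blast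
  qed
  then show ?thesis using c by (auto simp: W_def)
qed

text \<open>
  The force of the other vertices on a vertex is the sum of an odd periodic function over all
  residues, hence equal to its own negative.
\<close>

lemma polygon_torque:
  assumes n: "n \<ge> 1"
  shows "torque n (\<lambda>j. 2 * pi * real j / real n + c) i = 0"
proof -
  define W :: "int \<Rightarrow> real" where "W k = pair_force (2 * pi * of_int k / real n)" for k
  have per: "W (k + int n) = W k" for k
    unfolding W_def by (rule periodic_function_at_polygon[OF n]) (simp add: pair_force_def)
  have odd: "W (- k) = - W k" for k by (simp add: W_def pair_force_def)
  have "torque n (\<lambda>j. 2 * pi * real j / real n + c) i = (\<Sum>j=1..n. W (int i - int j))"
    by (simp add: torque_def W_def diff_divide_distrib right_diff_distrib)
  also have "\<dots> = (\<Sum>m<n. W (int m))" by (rule sum_periodic_row[of n W, OF n per])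
  also have "\<dots> = 0"
  proof -
    have "(\<Sum>m<n. W (int m)) = (\<Sum>m<n. W (0 - int m))" by (rule sum_periodic_reflect[of n W, OF n per, symmetric])
    also have "\<dots> = - (\<Sum>m<n. W (int m))" by (simp add: odd sum_negf)
    finally show ?thesis by simp
  qed
  finally show ?thesis .
qed

text \<open>
  A collision modulo \<open>\<pi>\<close> would make \<open>n\<close> divide \<open>2 (i - j)\<close>, hence \<open>i - j\<close>. For even \<open>n\<close> antipodal vertices
  do collide.
\<close>

lemma polygon_collision_free:
  assumes n: "n = 2 * p + 1"
  shows "collision_free n (\<lambda>j. 2 * pi * real j / real n + c)"
  unfolding collision_free_def
proof (intro ballI impI notI)
  fix i j assume ij: "i \<in> {1..n}" "j \<in> {1..n}" "i \<noteq> j"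
    and "(2 * pi * real i / real n + c) - (2 * pi * real j / real n + c) \<in> range (\<lambda>m::int. of_int m * pi)"
  then obtain m :: int where "2 * pi * real i / real n - 2 * pi * real j / real n = of_int m * pi" by auto
  moreover have "real n > 0" using n by simp
  ultimately have "pi * (2 * (real i - real j)) = pi * (of_int m * real n)"
    by (simp add: field_simps)
  then have "2 * (real i - real j) = of_int m * real n" by simp
  then have "real_of_int (2 * (int i - int j)) = of_int (m * int n)" by simp
  then have e: "2 * (int i - int j) = m * int n" by (simp only: of_int_eq_iff)
  have "coprime (int n) 2" using n by simp
  then have "int n dvd int i - int j"
    using e by (metis coprime_dvd_mult_right_iff dvd_triv_right)
  moreover have "\<bar>int i - int j\<bar> < int n" using ij by auto
  ultimately show False
    using dvd_imp_le_int[of "int i - int j" "int n"] ij(3) by linarith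
qed

lemma uniform_radius:
  fixes P :: "'a \<Rightarrow> real \<Rightarrow> bool"
  assumes "finite A" "\<And>a. a \<in> A \<Longrightarrow> \<forall>\<^sub>F h in nhds 0. P a h"
  shows "\<exists>\<rho>>0. \<forall>a\<in>A. \<forall>h. \<bar>h\<bar> < \<rho> \<longrightarrow> P a h"
proof -
  have "\<forall>\<^sub>F h in nhds 0. \<forall>a\<in>A. P a h" by (intro eventually_ball_finite assms(1) ballI assms(2))
  then show ?thesis by (auto simp: eventually_nhds_metric)
qed

text \<open>
  The linear terms of the Taylor expansions of the pairs cancel because the polygon is in
  equilibrium, and the Hessian dominates the remainders if these are at most half of its
  definiteness constant. The bound \<open>s\<close> on the distance from collisions is the one at which the force
  can be truncated without any effect near the polygon.
\<close>

lemma polygon_potential_strict_max: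
  assumes n: "n = 2 * p + 1" and p: "p \<ge> 1"
  defines "q \<equiv> \<lambda>j. 2 * pi * real j / real n"
  shows "\<exists>c C \<rho> s. 0 < c \<and> 0 < C \<and> 0 < \<rho> \<and> 0 < s \<and> (\<forall>\<phi>.
    (\<forall>i\<in>{1..n}. \<forall>j\<in>{1..n}. \<bar>(\<phi> i - \<phi> j) - (q i - q j)\<bar> < \<rho>) \<longrightarrow>
    (\<forall>i\<in>{1..n}. \<forall>j\<in>{1..n}. i \<noteq> j \<longrightarrow> s \<le> \<bar>sin (\<phi> i - \<phi> j)\<bar>) \<and>
    c * (\<Sum>i=1..n. \<Sum>j=1..n. ((\<phi> i - \<phi> j) - (q i - q j))\<^sup>2) \<le> potential n q - potential n \<phi> \<and>
    potential n q - potential n \<phi> \<le> C * (\<Sum>i=1..n. \<Sum>j=1..n. ((\<phi> i - \<phi> j) - (q i - q j))\<^sup>2))"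
proof -
  define \<theta> where "\<theta> i j = q i - q j" for i j
  define w where "w i j = cos (\<theta> i j) / \<bar>sin (\<theta> i j)\<bar> ^ 3" for i j
  define A where "A = {(i, j). i \<in> {1..n} \<and> j \<in> {1..n} \<and> i \<noteq> j}"
  have finA: "finite A" by (rule finite_subset[of _ "{1..n} \<times> {1..n}"]) (auto simp: A_def)
  have sin0: "sin (\<theta> i j) \<noteq> 0" if "(i, j) \<in> A" for i j
    using polygon_collision_free[OF n, of 0] that
    by (auto simp: collision_free_iff_sin A_def \<theta>_def q_def)
  have q_angle: "2 * pi * of_int (int i - int j) / real n = \<theta> i j" for i j
    by (simp add: \<theta>_def q_def right_diff_distrib diff_divide_distrib)
  obtain c0 where c0: "c0 > 0" and hess: "\<And>x. (\<Sum>i=1..n. \<Sum>j=1..n. w i j * (x i - x j)\<^sup>2)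
      \<le> - c0 * (\<Sum>i=1..n. \<Sum>j=1..n. (x i - x j)\<^sup>2)"
    using polygon_hessian_negative_definite[OF n p] unfolding q_angle w_def by blast
  define s where "s = Min ((\<lambda>(i, j). \<bar>sin (\<theta> i j)\<bar>) ` A) / 2"
  have "(1, 2) \<in> A" using n p by (simp add: A_def)
  then have Ane: "A \<noteq> {}" by blast
  have s: "s > 0" using finA Ane sin0 by (auto simp: s_def)
  have s_lt: "s < \<bar>sin (\<theta> i j)\<bar>" if "(i, j) \<in> A" for i j
  proof -
    have "2 * s \<le> \<bar>sin (\<theta> i j)\<bar>" using that finA by (auto simp: s_def intro!: Min_le image_eqI[of _ _ "(i, j)"])
    then show ?thesis using s by simp
  qed
  define T where "T i j h = (pair_potential (\<theta> i j + h) - pair_potential (\<theta> i j) - pair_force (\<theta> i j) * h - w i j * h\<^sup>2)"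
    for i j h
  have "\<exists>\<rho>>0. \<forall>a\<in>A. \<forall>h. \<bar>h\<bar> < \<rho> \<longrightarrow> (case a of (i, j) \<Rightarrow> \<bar>T i j h\<bar> \<le> c0 / 2 * h\<^sup>2 \<and> s \<le> \<bar>sin (\<theta> i j + h)\<bar>)"
  proof (rule uniform_radius[OF finA])
    fix a assume "a \<in> A"
    then obtain i j where a: "a = (i, j)" "(i, j) \<in> A" by (cases a) auto
    have "\<forall>\<^sub>F h in nhds 0. \<bar>T i j h\<bar> \<le> c0 / 2 * h\<^sup>2"
      using pair_potential_taylor[OF sin0[OF a(2)], of "c0 / 2"] c0
      by (auto simp: eventually_nhds_metric T_def w_def)
    moreover have "\<forall>\<^sub>F h in nhds 0. s < \<bar>sin (\<theta> i j + h)\<bar>"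
    proof (rule order_tendstoD(1))
      let ?f = "\<lambda>h. \<bar>sin (\<theta> i j + h)\<bar>"
      have "isCont ?f 0" by (intro continuous_intros)
      then have "(?f \<longlongrightarrow> ?f 0) (nhds 0)"
        unfolding isCont_def by (rule tendsto_at_iff_tendsto_nhds[THEN iffD1])
      then show "(?f \<longlongrightarrow> \<bar>sin (\<theta> i j)\<bar>) (nhds 0)" by simp
    qed (rule s_lt[OF a(2)])
    ultimately show "\<forall>\<^sub>F h in nhds 0. case a of (i, j) \<Rightarrow> \<bar>T i j h\<bar> \<le> c0 / 2 * h\<^sup>2 \<and> s \<le> \<bar>sin (\<theta> i j + h)\<bar>"
      by eventually_elim (simp add: a)
  qed
  then obtain \<rho> where \<rho>: "\<rho> > 0" and near: "\<And>i j h. (i, j) \<in> A \<Longrightarrow> \<bar>h\<bar> < \<rho> \<Longrightarrow>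
      \<bar>T i j h\<bar> \<le> c0 / 2 * h\<^sup>2 \<and> s \<le> \<bar>sin (\<theta> i j + h)\<bar>" by fastforce
  define B where "B = (\<Sum>i=1..n. \<Sum>j=1..n. \<bar>w i j\<bar>)"
  have wB: "\<bar>w i j\<bar> \<le> B" if "i \<in> {1..n}" "j \<in> {1..n}" for i j
  proof -
    have "\<bar>w i j\<bar> \<le> (\<Sum>j=1..n. \<bar>w i j\<bar>)" using that by (intro member_le_sum) auto
    also have "\<dots> \<le> B" unfolding B_def using that by (intro member_le_sum[of i]) (auto intro: sum_nonneg)
    finally show ?thesis .
  qed
  have B0: "B \<ge> 0" unfolding B_def by (intro sum_nonneg) auto
  show ?thesis
  proof (rule exI[of _ "c0 / 4"], rule exI[of _ "(B + c0 / 2) / 2"], rule exI[of _ \<rho>], rule exI[of _ s],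
      intro conjI allI impI)
    fix \<phi> :: coords
    assume small: "\<forall>i\<in>{1..n}. \<forall>j\<in>{1..n}. \<bar>(\<phi> i - \<phi> j) - (q i - q j)\<bar> < \<rho>"
    define x where "x i = \<phi> i - q i" for i
    have h: "(\<phi> i - \<phi> j) - (q i - q j) = x i - x j" "\<phi> i - \<phi> j = \<theta> i j + (x i - x j)" for i j
      by (simp_all add: x_def \<theta>_def)
    have small': "\<bar>x i - x j\<bar> < \<rho>" if "i \<in> {1..n}" "j \<in> {1..n}" for i j
      using small that unfolding h(1) by blast
    show "\<forall>i\<in>{1..n}. \<forall>j\<in>{1..n}. i \<noteq> j \<longrightarrow> s \<le> \<bar>sin (\<phi> i - \<phi> j)\<bar>"
      unfolding h(2) using near small' by (auto simp: A_def)
    have bound: "\<bar>T i j (x i - x j)\<bar> \<le> c0 / 2 * (x i - x j)\<^sup>2" if "i \<in> {1..n}" "j \<in> {1..n}" for i j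
      using near[of i j "x i - x j"] small'[OF that] that by (cases "i = j") (auto simp: A_def T_def)
    let ?H = "\<Sum>i=1..n. \<Sum>j=1..n. (x i - x j)\<^sup>2"
    let ?W = "\<Sum>i=1..n. \<Sum>j=1..n. w i j * (x i - x j)\<^sup>2"
    let ?T = "\<Sum>i=1..n. \<Sum>j=1..n. T i j (x i - x j)"
    have "torque n q i = 0" for i using polygon_torque[of n 0 i] n by (simp add: q_def)
    then have force: "(\<Sum>i=1..n. \<Sum>j=1..n. pair_force (\<theta> i j) * (x i - x j)) = 0"
      unfolding \<theta>_def sum_pair_force_diff by simp
    have expand: "pair_potential (\<phi> i - \<phi> j) = pair_potential (q i - q j) + pair_force (\<theta> i j) * (x i - x j)
        + w i j * (x i - x j)\<^sup>2 + T i j (x i - x j)" for i j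
      unfolding h(2) T_def by (simp add: \<theta>_def)
    have "2 * potential n \<phi> = 2 * potential n q + ?W + ?T"
      unfolding potential_as_double_sum expand sum.distrib force by simp
    moreover have "?T \<le> c0 / 2 * ?H"
      unfolding sum_distrib_left by (intro sum_mono abs_le_D1[OF bound])
    moreover have "- ?T \<le> c0 / 2 * ?H"
      unfolding sum_distrib_left sum_negf[symmetric] by (intro sum_mono abs_le_D2[OF bound])
    moreover have "?W \<le> - c0 * ?H" by (rule hess)
    moreover have "- (B * ?H) \<le> ?W"
      unfolding sum_distrib_left sum_negf[symmetric]
    proof (intro sum_mono)
      fix i j assume "i \<in> {1..n}" "j \<in> {1..n}"
      then have "- B \<le> w i j" using abs_le_D2[OF wB[of i j]] by simp
      then show "- (B * (x i - x j)\<^sup>2) \<le> w i j * (x i - x j)\<^sup>2"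
        using mult_right_mono[of "- B" "w i j" "(x i - x j)\<^sup>2"] by simp
    qed
    ultimately show
      "c0 / 4 * (\<Sum>i=1..n. \<Sum>j=1..n. ((\<phi> i - \<phi> j) - (q i - q j))\<^sup>2) \<le> potential n q - potential n \<phi>"
      "potential n q - potential n \<phi> \<le> (B + c0 / 2) / 2 * (\<Sum>i=1..n. \<Sum>j=1..n. ((\<phi> i - \<phi> j) - (q i - q j))\<^sup>2)"
      unfolding h(1) by (simp_all add: algebra_simps)
  qed (use c0 B0 \<rho> s in auto)
qed


section \<open>The reduced energy near the polygon\<close>

text \<open>
  The matrix expressing the angles by the coordinates \<open>u\<^sub>2, ..., u\<^sub>n\<close>.
\<close>

definition angle_coeff :: "nat \<Rightarrow> nat \<Rightarrow> real" where
  "angle_coeff j k = (if j = k then 1 else 0) - (if j \<le> k then 1 / real k else 0)"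

lemma angle_coeff_bound: "k \<ge> 2 \<Longrightarrow> \<bar>angle_coeff j k\<bar> \<le> 1"
  by (auto simp: angle_coeff_def field_simps)

lemma angles_of_linear:
  assumes "j \<in> {1..n}"
  shows "angles_of n u j = (\<Sum>k=2..n. angle_coeff j k * u k)"
proof -
  have "(\<Sum>k=2..n. (if j \<le> k then 1 / real k else 0) * u k) = (\<Sum>k=max 2 j..n. u k / real k)"
    by (rule sum.mono_neutral_cong_right) auto
  moreover have "(\<Sum>k=2..n. (if j = k then 1 else 0) * u k) = (if 2 \<le> j then u j else 0)"
  proof -
    have "(\<Sum>k=2..n. (if j = k then 1 else 0) * u k) = (\<Sum>k=2..n. if j = k then u k else 0)"
      by (intro sum.cong refl) auto
    then show ?thesis using assms by (simp add: sum.delta')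
  qed
  ultimately show ?thesis by (simp add: angles_of_def angle_coeff_def left_diff_distrib sum_subtractf)
qed

lemma angles_of_has_derivative:
  assumes j: "j \<in> {1..n}" and d: "\<And>k. k \<in> {2..n} \<Longrightarrow> ((\<lambda>t. u t k) has_real_derivative d k) (at t within S)"
  shows "((\<lambda>t. angles_of n (u t) j) has_real_derivative (\<Sum>k=2..n. angle_coeff j k * d k)) (at t within S)"
  unfolding angles_of_linear[OF j] by (intro DERIV_sum DERIV_cmult d)

text \<open>
  The force in the direction of \<open>u\<^sub>k\<close>, by the chain rule.
\<close>

definition generalized_force :: "nat \<Rightarrow> coords \<Rightarrow> nat \<Rightarrow> real" where
  "generalized_force n u k = (\<Sum>i=1..n. angle_coeff i k * torque n (angles_of n u) i)"

lemma reduced_potential_has_derivative_along: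
  assumes "collision_free n (angles_of n (u t))"
    and d: "\<And>k. k \<in> {2..n} \<Longrightarrow> ((\<lambda>t. u t k) has_real_derivative d k) (at t within S)"
  shows "((\<lambda>t. reduced_potential n (u t)) has_real_derivative (\<Sum>k=2..n. d k * generalized_force n (u t) k)) (at t within S)"
proof -
  have "((\<lambda>t. reduced_potential n (u t)) has_real_derivative
      (\<Sum>i=1..n. (\<Sum>k=2..n. angle_coeff i k * d k) * torque n (angles_of n (u t)) i)) (at t within S)"
    unfolding reduced_potential_def
    using assms by (intro potential_has_derivative_along angles_of_has_derivative) auto
  also have "(\<Sum>i=1..n. (\<Sum>k=2..n. angle_coeff i k * d k) * torque n (angles_of n (u t)) i) =
      (\<Sum>k=2..n. d k * generalized_force n (u t) k)"
    unfolding generalized_force_def sum_distrib_left sum_distrib_right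
    by (subst sum.swap) (intro sum.cong refl, simp add: mult_ac)
  finally show ?thesis .
qed

lemma has_derivative_coordinate:
  "((\<lambda>s. (u(k := s)) i) has_real_derivative (if i = k then 1 else 0)) (at a within S)" for u :: coords
  by (cases "i = k") auto

lemma partial_pos_reduced:
  assumes "collision_free n (angles_of n u)" "k \<in> {2..n}"
  shows "partial_pos (reduced_hamiltonian n) k (u, v) = - generalized_force n u k"
proof -
  have "((\<lambda>s. reduced_potential n (u(k := s))) has_real_derivative
      (\<Sum>i=2..n. (if i = k then 1 else 0) * generalized_force n (u(k := u k)) i)) (at (u k))"
    by (rule reduced_potential_has_derivative_along) (use assms in \<open>auto intro: has_derivative_coordinate\<close>)
  also have "(\<Sum>i=2..n. (if i = k then 1 else 0) * generalized_force n (u(k := u k)) i) = generalized_force n u k"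
    using assms(2) by (simp add: if_distrib[of "\<lambda>x. x * _"] sum.delta' cong: if_cong)
  finally have "((\<lambda>s. (\<Sum>i=2..n. (v i)\<^sup>2 / (2 * jacobi_mass i)) - reduced_potential n (u(k := s)))
      has_real_derivative 0 - generalized_force n u k) (at (u k))"
    by (intro DERIV_diff DERIV_const)
  then show ?thesis unfolding partial_pos_def reduced_hamiltonian_def by (simp add: DERIV_imp_deriv)
qed

lemma kinetic_has_derivative_along:
  assumes "\<And>k. k \<in> {2..n} \<Longrightarrow> ((\<lambda>t. v t k) has_real_derivative d k) (at t within S)"
  shows "((\<lambda>t. \<Sum>k=2..n. (v t k)\<^sup>2 / (2 * jacobi_mass k)) has_real_derivative
     (\<Sum>k=2..n. v t k * d k / jacobi_mass k)) (at t within S)"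
proof (intro DERIV_sum)
  fix k assume k: "k \<in> {2..n}"
  have "((\<lambda>t. (v t k)\<^sup>2 / (2 * jacobi_mass k)) has_real_derivative
      (2 * v t k * d k) / (2 * jacobi_mass k)) (at t within S)"
    by (intro DERIV_cdivide) (auto intro!: derivative_eq_intros assms[OF k])
  then show "((\<lambda>t. (v t k)\<^sup>2 / (2 * jacobi_mass k)) has_real_derivative v t k * d k / jacobi_mass k) (at t within S)"
    by simp
qed

lemma partial_mom_reduced:
  assumes "k \<in> {2..n}"
  shows "partial_mom (reduced_hamiltonian n) k (u, v) = v k / jacobi_mass k"
proof -
  have "((\<lambda>s. \<Sum>i=2..n. ((v(k := s)) i)\<^sup>2 / (2 * jacobi_mass i)) has_real_derivative
      (\<Sum>i=2..n. (v(k := v k)) i * (if i = k then 1 else 0) / jacobi_mass i)) (at (v k))"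
    by (rule kinetic_has_derivative_along) (rule has_derivative_coordinate)
  also have "(\<Sum>i=2..n. (v(k := v k)) i * (if i = k then 1 else 0) / jacobi_mass i) =
      (\<Sum>i=2..n. if i = k then v i / jacobi_mass i else 0)"
    by (intro sum.cong refl) auto
  also have "\<dots> = v k / jacobi_mass k" using assms by simp
  finally have "((\<lambda>s. (\<Sum>i=2..n. ((v(k := s)) i)\<^sup>2 / (2 * jacobi_mass i)) - reduced_potential n u)
      has_real_derivative v k / jacobi_mass k - 0) (at (v k))"
    by (intro DERIV_diff DERIV_const)
  then show ?thesis unfolding partial_mom_def reduced_hamiltonian_def by (simp add: DERIV_imp_deriv)
qed

lemma reduced_solution_iff:
  "hamiltonian_solution {2..n} (reduced_phase_space n) (reduced_hamiltonian n) J z \<longleftrightarrow>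
    (\<forall>t\<in>J. collision_free n (angles_of n (fst (z t))) \<and>
      (\<forall>k\<in>{2..n}. ((\<lambda>s. fst (z s) k) has_real_derivative snd (z t) k / jacobi_mass k) (at t within J) \<and>
         ((\<lambda>s. snd (z s) k) has_real_derivative generalized_force n (fst (z t)) k) (at t within J)))"
proof -
  have "z t \<in> reduced_phase_space n \<longleftrightarrow> collision_free n (angles_of n (fst (z t)))" for t
    by (cases "z t") (simp add: reduced_phase_space_def)
  moreover have "partial_mom (reduced_hamiltonian n) k (z t) = snd (z t) k / jacobi_mass k" if "k \<in> {2..n}" for k t
    using partial_mom_reduced[OF that, of "fst (z t)" "snd (z t)"] by simp
  moreover have "partial_pos (reduced_hamiltonian n) k (z t) = - generalized_force n (fst (z t)) k"
    if "collision_free n (angles_of n (fst (z t)))" "k \<in> {2..n}" for k t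
    using partial_pos_reduced[OF that, of "snd (z t)"] by simp
  ultimately show ?thesis unfolding hamiltonian_solution_def by (auto cong: conj_cong)
qed

lemma reduced_energy_conserved:
  assumes "collision_free n (angles_of n (fst (z t)))"
    and "\<And>k. k \<in> {2..n} \<Longrightarrow> ((\<lambda>s. fst (z s) k) has_real_derivative snd (z t) k / jacobi_mass k) (at t within J)"
    and "\<And>k. k \<in> {2..n} \<Longrightarrow> ((\<lambda>s. snd (z s) k) has_real_derivative generalized_force n (fst (z t)) k) (at t within J)"
  shows "((\<lambda>s. reduced_hamiltonian n (z s)) has_real_derivative 0) (at t within J)"
proof -
  have "((\<lambda>s. (\<Sum>k=2..n. (snd (z s) k)\<^sup>2 / (2 * jacobi_mass k)) - reduced_potential n (fst (z s))) has_real_derivative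
     (\<Sum>k=2..n. snd (z t) k * generalized_force n (fst (z t)) k / jacobi_mass k) -
     (\<Sum>k=2..n. snd (z t) k / jacobi_mass k * generalized_force n (fst (z t)) k)) (at t within J)"
    using assms by (intro DERIV_diff kinetic_has_derivative_along reduced_potential_has_derivative_along) auto
  then show ?thesis by (simp add: reduced_hamiltonian_def case_prod_unfold)
qed

lemma jacobi_u_polygon:
  assumes "k \<in> {2..n}"
  shows "jacobi_u (\<lambda>j. 2 * pi * real j / real n + c) k = real k / real n * pi"
proof -
  have s: "(\<Sum>i=1..m. a * real i + c) = a * (real m * (real m + 1)) / 2 + real m * c" for a m
    by (induction m) (simp_all add: algebra_simps add_divide_distrib)
  have k: "real (k - 1) = real k - 1" "real k - 1 \<noteq> 0" using assms by auto
  have "(\<Sum>i=1..k-1. 2 * pi * real i / real n + c) = (2 * pi / real n) * ((real k - 1) * real k) / 2 + (real k - 1) * c"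
    using s[of "2 * pi / real n" "k - 1"] k(1) by (simp add: mult_ac)
  also have "\<dots> / (real k - 1) = pi / real n * real k + c"
    using k(2) by (simp add: add_divide_distrib)
  finally show ?thesis by (simp add: jacobi_u_def diff_divide_distrib algebra_simps)
qed

lemma angles_of_polygon:
  assumes "j \<in> {1..n}"
  shows "angles_of n (fst (polygon_equilibrium n)) j = 2 * pi * real j / real n - jacobi_g n (\<lambda>j. 2 * pi * real j / real n)"
proof -
  have "angles_of n (fst (polygon_equilibrium n)) j = angles_of n (jacobi_u (\<lambda>j. 2 * pi * real j / real n)) j"
    unfolding angles_of_linear[OF assms]
    using jacobi_u_polygon[of _ n 0] by (intro sum.cong refl) (simp add: polygon_equilibrium_def)
  then show ?thesis using angles_of_jacobi_u[OF assms] by simp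
qed

lemma jacobi_u_as_mean_difference:
  assumes "k \<ge> 2"
  shows "jacobi_u x k = (\<Sum>i=1..k-1. x k - x i) / (real k - 1)"
  using assms by (simp add: jacobi_u_def sum_subtractf of_nat_diff diff_divide_distrib)

text \<open>
  A Jacobi coordinate is a mean of pairwise differences, so its square is at most the mean of
  their squares.
\<close>

lemma jacobi_u_square_bound:
  assumes "k \<in> {2..n}"
  shows "(jacobi_u x k)\<^sup>2 \<le> (\<Sum>i=1..n. (x k - x i)\<^sup>2)"
proof -
  have k: "real k - 1 \<ge> 1" "card {1..k-1} = k - 1" "real (k - 1) = real k - 1" using assms by (auto simp: of_nat_diff)
  have "(jacobi_u x k)\<^sup>2 = (\<Sum>i=1..k-1. x k - x i)\<^sup>2 / (real k - 1)\<^sup>2"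
    using assms by (simp add: jacobi_u_as_mean_difference power_divide)
  also have "\<dots> \<le> ((\<Sum>i=1..k-1. (x k - x i)\<^sup>2) * (real k - 1)) / (real k - 1)\<^sup>2"
    using sum_squared_le_sum_of_squares[of "\<lambda>i. x k - x i" "{1..k-1}"] k(2,3)
    by (intro divide_right_mono) auto
  also have "\<dots> = (\<Sum>i=1..k-1. (x k - x i)\<^sup>2) / (real k - 1)"
    using k(1) by (simp add: power2_eq_square)
  also have "\<dots> \<le> (\<Sum>i=1..k-1. (x k - x i)\<^sup>2)"
    using divide_left_mono[of 1 "real k - 1" "\<Sum>i=1..k-1. (x k - x i)\<^sup>2"] k(1) by (simp add: sum_nonneg)
  also have "\<dots> \<le> (\<Sum>i=1..n. (x k - x i)\<^sup>2)"
    using assms by (intro sum_mono2) auto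
  finally show ?thesis .
qed

lemma angles_of_diff: "j \<in> {1..n} \<Longrightarrow> angles_of n u j - angles_of n u' j = angles_of n (\<lambda>k. u k - u' k) j"
  by (simp add: angles_of_linear right_diff_distrib sum_subtractf)

text \<open>
  The pairwise differences of the angles determine the reduced configuration. This transports the
  definiteness of the Hessian from differences of angles to the coordinates \<open>u\<close>.
\<close>

lemma sum_squares_le_pair_differences:
  assumes "n \<ge> 1"
  shows "(\<Sum>k=2..n. (u k - u' k)\<^sup>2) \<le> (\<Sum>i=1..n. \<Sum>j=1..n.
     ((angles_of n u i - angles_of n u j) - (angles_of n u' i - angles_of n u' j))\<^sup>2)"
proof -
  let ?x = "angles_of n (\<lambda>k. u k - u' k)"
  have "(\<Sum>k=2..n. (u k - u' k)\<^sup>2) = (\<Sum>k=2..n. (jacobi_u ?x k)\<^sup>2)"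
    by (intro sum.cong refl) (simp add: jacobi_u_angles_of)
  also have "\<dots> \<le> (\<Sum>k=2..n. \<Sum>i=1..n. (?x k - ?x i)\<^sup>2)" by (intro sum_mono jacobi_u_square_bound)
  also have "\<dots> \<le> (\<Sum>k=1..n. \<Sum>i=1..n. (?x k - ?x i)\<^sup>2)" by (intro sum_mono2) (auto intro: sum_nonneg)
  also have "\<dots> = (\<Sum>i=1..n. \<Sum>j=1..n.
     ((angles_of n u i - angles_of n u j) - (angles_of n u' i - angles_of n u' j))\<^sup>2)"
    by (intro sum.cong refl) (simp flip: angles_of_diff add: algebra_simps)
  finally show ?thesis .
qed

lemma coordinate_le_state_dist:
  assumes "finite I" "k \<in> I"
  shows "\<bar>fst x k - fst y k\<bar> \<le> state_dist I x y"
proof -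
  have "(fst x k - fst y k)\<^sup>2 \<le> (fst x k - fst y k)\<^sup>2 + (snd x k - snd y k)\<^sup>2" by simp
  also have "\<dots> \<le> (\<Sum>i\<in>I. (fst x i - fst y i)\<^sup>2 + (snd x i - snd y i)\<^sup>2)"
    using assms by (intro member_le_sum[of k I "\<lambda>i. (fst x i - fst y i)\<^sup>2 + (snd x i - snd y i)\<^sup>2"]) auto
  finally have "(fst x k - fst y k)\<^sup>2 \<le> (\<Sum>i\<in>I. (fst x i - fst y i)\<^sup>2 + (snd x i - snd y i)\<^sup>2)" .
  from real_sqrt_le_mono[OF this] show ?thesis by (simp only: state_dist_def real_sqrt_abs)
qed

lemma state_dist_square:
  "(state_dist I x y)\<^sup>2 = (\<Sum>i\<in>I. (fst x i - fst y i)\<^sup>2) + (\<Sum>i\<in>I. (snd x i - snd y i)\<^sup>2)"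
  unfolding state_dist_def sum.distrib[symmetric] by (intro real_sqrt_pow2 sum_nonneg) auto

lemma state_dist_nonneg: "state_dist I x y \<ge> 0"
  unfolding state_dist_def by (intro real_sqrt_ge_zero sum_nonneg) auto

lemma pair_difference_le_state_dist:
  assumes "i \<in> {1..n}" "j \<in> {1..n}"
  shows "\<bar>(angles_of n (fst x) i - angles_of n (fst x) j) - (angles_of n (fst y) i - angles_of n (fst y) j)\<bar>
    \<le> 2 * real n * state_dist {2..n} x y"
proof -
  let ?d = "state_dist {2..n} x y"
  have one: "\<bar>angles_of n (fst x) l - angles_of n (fst y) l\<bar> \<le> real n * ?d" if l: "l \<in> {1..n}" for l
  proof -
    have "\<bar>angles_of n (fst x) l - angles_of n (fst y) l\<bar> = \<bar>\<Sum>k=2..n. angle_coeff l k * (fst x k - fst y k)\<bar>"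
      using l by (simp add: angles_of_linear right_diff_distrib sum_subtractf)
    also have "\<dots> \<le> (\<Sum>k=2..n. \<bar>angle_coeff l k * (fst x k - fst y k)\<bar>)" by (rule sum_abs)
    also have "\<dots> \<le> (\<Sum>k=2..n. 1 * ?d)"
      unfolding abs_mult using angle_coeff_bound
      by (intro sum_mono mult_mono coordinate_le_state_dist) auto
    also have "\<dots> = real (n - 1) * ?d" by simp
    also have "\<dots> \<le> real n * ?d" by (intro mult_right_mono state_dist_nonneg) auto
    finally show ?thesis .
  qed
  show ?thesis using one[OF assms(1)] one[OF assms(2)] by linarith
qed

text \<open>
  The lower bound makes the energy a Lyapunov function, the upper bound turns it into an explicit
  choice of \<open>\<delta>\<close>. The kinetic part is comparable to the squared momenta because all
  Jacobi masses lie between \<open>1/2\<close> and 1.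
\<close>

lemma reduced_energy_bounds:
  assumes n: "n = 2 * p + 1" and p: "p \<ge> 1"
  defines "X \<equiv> polygon_equilibrium n"
  shows "\<exists>c C r s. 0 < c \<and> 0 < C \<and> 0 < r \<and> 0 < s \<and> (\<forall>z. state_dist {2..n} z X < r \<longrightarrow>
    (\<forall>i\<in>{1..n}. \<forall>j\<in>{1..n}. i \<noteq> j \<longrightarrow> s \<le> \<bar>sin (angles_of n (fst z) i - angles_of n (fst z) j)\<bar>) \<and>
    c * (state_dist {2..n} z X)\<^sup>2 \<le> reduced_hamiltonian n z - reduced_hamiltonian n X \<and>
    reduced_hamiltonian n z - reduced_hamiltonian n X \<le> C * (state_dist {2..n} z X)\<^sup>2)"
proof -
  let ?q = "\<lambda>j. 2 * pi * real j / real n"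
  obtain c C \<rho> s where pos: "c > 0" "C > 0" "\<rho> > 0" "s > 0" and near: "\<And>\<phi>.
    (\<forall>i\<in>{1..n}. \<forall>j\<in>{1..n}. \<bar>(\<phi> i - \<phi> j) - (?q i - ?q j)\<bar> < \<rho>) \<Longrightarrow>
    (\<forall>i\<in>{1..n}. \<forall>j\<in>{1..n}. i \<noteq> j \<longrightarrow> s \<le> \<bar>sin (\<phi> i - \<phi> j)\<bar>) \<and>
    c * (\<Sum>i=1..n. \<Sum>j=1..n. ((\<phi> i - \<phi> j) - (?q i - ?q j))\<^sup>2) \<le> potential n ?q - potential n \<phi> \<and>
    potential n ?q - potential n \<phi> \<le> C * (\<Sum>i=1..n. \<Sum>j=1..n. ((\<phi> i - \<phi> j) - (?q i - ?q j))\<^sup>2)"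
    using polygon_potential_strict_max[OF n p] by blast
  have n1: "n \<ge> 1" "real n > 0" using n by auto
  let ?D = "\<lambda>z. state_dist {2..n} z X"
  show ?thesis
  proof (rule exI[of _ "min (1/2) c"], rule exI[of _ "1 + C * (real n * (real n * (2 * real n)\<^sup>2))"],
      rule exI[of _ "\<rho> / (2 * real n)"], rule exI[of _ s], intro conjI allI impI)
    fix z assume small: "?D z < \<rho> / (2 * real n)"
    let ?\<phi> = "angles_of n (fst z)" and ?\<psi> = "angles_of n (fst X)"
    have qX: "?q i - ?q j = ?\<psi> i - ?\<psi> j" if "i \<in> {1..n}" "j \<in> {1..n}" for i j
      using angles_of_polygon[OF that(1)] angles_of_polygon[OF that(2)] by (simp add: X_def)
    have hD: "\<bar>(?\<phi> i - ?\<phi> j) - (?q i - ?q j)\<bar> \<le> 2 * real n * ?D z" if "i \<in> {1..n}" "j \<in> {1..n}" for i j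
      unfolding qX[OF that] by (rule pair_difference_le_state_dist[OF that])
    have "2 * real n * ?D z < \<rho>" using small n1 by (simp add: field_simps)
    then have "\<forall>i\<in>{1..n}. \<forall>j\<in>{1..n}. \<bar>(?\<phi> i - ?\<phi> j) - (?q i - ?q j)\<bar> < \<rho>"
      using hD by fastforce
    note nearz = near[OF this]
    then show "\<forall>i\<in>{1..n}. \<forall>j\<in>{1..n}. i \<noteq> j \<longrightarrow> s \<le> \<bar>sin (?\<phi> i - ?\<phi> j)\<bar>" by blast
    let ?H = "\<Sum>i=1..n. \<Sum>j=1..n. ((?\<phi> i - ?\<phi> j) - (?q i - ?q j))\<^sup>2"
    let ?P = "\<Sum>k=2..n. (fst z k - fst X k)\<^sup>2" and ?V = "\<Sum>k=2..n. (snd z k)\<^sup>2"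
    have D2: "(?D z)\<^sup>2 = ?P + ?V" by (simp add: state_dist_square X_def polygon_equilibrium_def)
    have "?H = (\<Sum>i=1..n. \<Sum>j=1..n. ((?\<phi> i - ?\<phi> j) - (?\<psi> i - ?\<psi> j))\<^sup>2)"
      using qX by (intro sum.cong refl) simp
    then have PH: "?P \<le> ?H" using sum_squares_le_pair_differences[OF n1(1), of "fst z" "fst X"] by simp
    have HD: "?H \<le> real n * (real n * (2 * real n)\<^sup>2) * (?D z)\<^sup>2"
    proof -
      have "?H \<le> (\<Sum>i=1..n. \<Sum>j=1..n. (2 * real n * ?D z)\<^sup>2)"
      proof (intro sum_mono)
        fix i j assume "i \<in> {1..n}" "j \<in> {1..n}"
        from hD[OF this] show "((?\<phi> i - ?\<phi> j) - (?q i - ?q j))\<^sup>2 \<le> (2 * real n * ?D z)\<^sup>2"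
          using power_mono[of "\<bar>(?\<phi> i - ?\<phi> j) - (?q i - ?q j)\<bar>" _ 2] by (metis abs_ge_zero power2_abs)
      qed
      also have "\<dots> = real n * (real n * (2 * real n)\<^sup>2) * (?D z)\<^sup>2" by (simp add: power_mult_distrib)
      finally show ?thesis .
    qed
    have pot: "reduced_potential n (fst X) = potential n ?q"
      unfolding reduced_potential_def
      by (rule potential_cong[of _ _ _ "- jacobi_g n ?q"]) (simp add: X_def angles_of_polygon)
    let ?K = "\<Sum>k=2..n. (snd z k)\<^sup>2 / (2 * jacobi_mass k)"
    have E: "reduced_hamiltonian n z - reduced_hamiltonian n X = ?K + (potential n ?q - potential n ?\<phi>)"
      using pot by (simp add: reduced_hamiltonian_def case_prod_unfold reduced_potential_def X_def polygon_equilibrium_def)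
    have K: "1 / 2 * ?V \<le> ?K" "?K \<le> ?V"
    proof -
      have "1 / 2 * (snd z k)\<^sup>2 \<le> (snd z k)\<^sup>2 / (2 * jacobi_mass k) \<and> (snd z k)\<^sup>2 / (2 * jacobi_mass k) \<le> (snd z k)\<^sup>2"
        if "k \<in> {2..n}" for k
      proof -
        have m: "1 / 2 \<le> jacobi_mass k" "jacobi_mass k \<le> 1" using that by (auto simp: jacobi_mass_def field_simps)
        have "(snd z k)\<^sup>2 / 2 \<le> (snd z k)\<^sup>2 / (2 * jacobi_mass k)" using m by (intro divide_left_mono) auto
        moreover have "(snd z k)\<^sup>2 / (2 * jacobi_mass k) \<le> (snd z k)\<^sup>2 / 1" using m by (intro divide_left_mono) auto
        ultimately show ?thesis by simp
      qed
      then show "1 / 2 * ?V \<le> ?K" "?K \<le> ?V" unfolding sum_distrib_left by (auto intro!: sum_mono)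
    qed
    have P0: "?P \<ge> 0" "?V \<ge> 0" by (auto intro: sum_nonneg)
    have "min (1/2) c * (?D z)\<^sup>2 = min (1/2) c * ?P + min (1/2) c * ?V" unfolding D2 by (simp add: distrib_left)
    also have "\<dots> \<le> c * ?P + 1 / 2 * ?V" using P0 by (intro add_mono mult_right_mono) auto
    also have "\<dots> \<le> c * ?H + ?K" using PH K pos by (intro add_mono mult_left_mono) auto
    finally show "min (1/2) c * (?D z)\<^sup>2 \<le> reduced_hamiltonian n z - reduced_hamiltonian n X"
      unfolding E using nearz by linarith
    have "reduced_hamiltonian n z - reduced_hamiltonian n X \<le> ?V + C * ?H"
      unfolding E using nearz K by linarith
    also have "\<dots> \<le> (?D z)\<^sup>2 + C * (real n * (real n * (2 * real n)\<^sup>2) * (?D z)\<^sup>2)"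
      using HD P0 pos by (intro add_mono mult_left_mono) (auto simp: D2)
    finally show "reduced_hamiltonian n z - reduced_hamiltonian n X \<le>
        (1 + C * (real n * (real n * (2 * real n)\<^sup>2))) * (?D z)\<^sup>2" by (simp add: algebra_simps)
  qed (use pos n1 in \<open>auto simp: add_pos_nonneg\<close>)
qed


section \<open>Stability\<close>

text \<open>
  Hamilton's equations with the truncated force form a globally Lipschitz system, being built from
  the truncated force and the coordinates by linear operations.
\<close>

lemma truncated_reduced_solution:
  assumes s: "s > 0"
  shows "\<exists>u v. u 0 = u0 \<and> v 0 = v0 \<and> (\<forall>t\<ge>0. \<forall>k\<in>{2..n}.
     ((\<lambda>t. u t k) has_real_derivative v t k / jacobi_mass k) (at t within {0..}) \<and>
     ((\<lambda>t. v t k) has_real_derivative (\<Sum>i=1..n. angle_coeff i k *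
        (\<Sum>j=1..n. truncated_force s (angles_of n (u t) i - angles_of n (u t) j)))) (at t within {0..}))"
proof -
  let ?ang = "\<lambda>(u :: coords) i. \<Sum>k=2..n. angle_coeff i k * u k"
  let ?f = "\<lambda>k (u :: coords) (v :: coords). (1 / jacobi_mass k) * v k"
  let ?g = "\<lambda>k (u :: coords) (v :: coords). \<Sum>i=1..n. angle_coeff i k * (\<Sum>j=1..n. truncated_force s (?ang u i - ?ang u j))"
  have "\<exists>u v. u 0 = u0 \<and> v 0 = v0 \<and> (\<forall>t\<ge>0. \<forall>k\<in>{2..n}.
     ((\<lambda>t. u t k) has_real_derivative ?f k (\<lambda>i. if i \<in> {2..n} then u t i else 0) (\<lambda>i. if i \<in> {2..n} then v t i else 0)) (at t within {0..}) \<and>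
     ((\<lambda>t. v t k) has_real_derivative ?g k (\<lambda>i. if i \<in> {2..n} then u t i else 0) (\<lambda>i. if i \<in> {2..n} then v t i else 0)) (at t within {0..}))"
    by (intro lipschitz_system_global_solution finite_atLeastAtMost
        lipschitz_on_sum_exists lipschitz_on_cmult_exists lipschitz_on_diff_exists
        lipschitz_on_compose_exists[OF truncated_force_lipschitz[OF s]] lipschitz_coordinate)
  then obtain u v where uv: "u 0 = u0" "v 0 = v0" and d: "\<And>t k. t \<ge> 0 \<Longrightarrow> k \<in> {2..n} \<Longrightarrow>
     ((\<lambda>t. u t k) has_real_derivative ?f k (\<lambda>i. if i \<in> {2..n} then u t i else 0) (\<lambda>i. if i \<in> {2..n} then v t i else 0)) (at t within {0..}) \<and>
     ((\<lambda>t. v t k) has_real_derivative ?g k (\<lambda>i. if i \<in> {2..n} then u t i else 0) (\<lambda>i. if i \<in> {2..n} then v t i else 0)) (at t within {0..})"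
    by blast
  have ang: "?ang (\<lambda>i. if i \<in> {2..n} then w i else 0) j = angles_of n w j" if "j \<in> {1..n}" for w j
    unfolding angles_of_linear[OF that] by (intro sum.cong refl) auto
  have g_eq: "?g k (\<lambda>i. if i \<in> {2..n} then w i else 0) w' = (\<Sum>i=1..n. angle_coeff i k *
        (\<Sum>j=1..n. truncated_force s (angles_of n w i - angles_of n w j)))" for k w w'
    by (intro sum.cong refl arg_cong2[where f = "(*)"]) (simp only: ang)
  have f_eq: "?f k w' (\<lambda>i. if i \<in> {2..n} then w i else 0) = w k / jacobi_mass k" if "k \<in> {2..n}" for k w w'
    using that by simp
  show ?thesis
  proof (rule exI[of _ u], rule exI[of _ v], intro conjI uv allI impI ballI)
    fix t :: real and k assume t: "t \<ge> 0" and k: "k \<in> {2..n}"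
    show "((\<lambda>t. u t k) has_real_derivative v t k / jacobi_mass k) (at t within {0..})"
      using d[OF t k] unfolding f_eq[OF k] by (rule conjunct1)
    show "((\<lambda>t. v t k) has_real_derivative (\<Sum>i=1..n. angle_coeff i k *
        (\<Sum>j=1..n. truncated_force s (angles_of n (u t) i - angles_of n (u t) j)))) (at t within {0..})"
      using d[OF t k] unfolding g_eq by (rule conjunct2)
  qed
qed

text \<open>
  At the first time \<open>\<tau>\<close> at which the distance \<open>d\<close> reaches \<open>\<rho>\<close>, the energy \<open>e\<close> would be at least
  \<open>c \<rho>\<^sup>2\<close>; but up to then the motion stays in the region where the energy is conserved, and it started
  below that value. Conservation is required only in the region \<open>d < r\<close>, so that the lemma applies
  both to solutions of the original system and to solutions of the truncated one.
\<close>

lemma energy_confinement: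
  fixes d e :: "real \<Rightarrow> real"
  assumes J: "J = {0..} \<or> J = {0..<T}"
    and cont: "continuous_on J d"
    and conserved: "\<And>t. t \<in> J \<Longrightarrow> d t < r \<Longrightarrow> (e has_real_derivative 0) (at t within J)"
    and coercive: "\<And>t. t \<in> J \<Longrightarrow> d t < r \<Longrightarrow> c * (d t)\<^sup>2 \<le> e t"
    and init: "d 0 < \<rho>" "e 0 < c * \<rho>\<^sup>2" and \<rho>: "\<rho> < r"
    and t: "t \<in> J"
  shows "d t < \<rho>"
proof (rule ccontr)
  assume "\<not> d t < \<rho>"
  have sub: "{0..b} \<subseteq> J" if "b \<in> J" for b using J that by auto
  have t0: "0 \<le> t" using J t by auto
  have cont': "continuous_on {0..x} d" if "x \<le> t" for x
    by (rule continuous_on_subset[OF cont order_trans[OF _ sub[OF t]]]) (use that in auto)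
  let ?S = "{x \<in> {0..t}. d x = \<rho>}"
  have "closed ?S" by (intro continuous_closed_preimage_constant cont') auto
  then have "compact ?S" by (auto simp: compact_eq_bounded_closed intro: bounded_subset[of "{0..t}"])
  moreover have "?S \<noteq> {}"
    using IVT'[of d 0 \<rho> t] cont' init(1) \<open>\<not> d t < \<rho>\<close> t0 by auto
  ultimately obtain \<tau> where \<tau>: "0 \<le> \<tau>" "\<tau> \<le> t" "d \<tau> = \<rho>" and first: "\<And>x. x \<in> ?S \<Longrightarrow> \<tau> \<le> x"
    using compact_attains_inf[of ?S] by auto
  have before: "d x < \<rho>" if x: "0 \<le> x" "x < \<tau>" for x
  proof (rule ccontr)
    assume "\<not> d x < \<rho>"
    moreover have "continuous_on {0..x} d" using x \<tau> by (intro cont') simp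
    ultimately obtain y where "0 \<le> y" "y \<le> x" "d y = \<rho>"
      using IVT'[of d 0 \<rho> x] init(1) x by auto
    then show False using first[of y] x \<tau> by auto
  qed
  have low: "d x < r" if "x \<in> {0..\<tau>}" for x
    using that before[of x] \<tau>(3) \<rho> by (cases "x = \<tau>") auto
  have J\<tau>: "{0..\<tau>} \<subseteq> J" using sub[OF t] \<tau> by auto
  have "\<exists>k. \<forall>x\<in>{0..\<tau>}. e x = k"
  proof (rule has_field_derivative_zero_constant)
    fix x assume "x \<in> {0..\<tau>}"
    then have "(e has_real_derivative 0) (at x within J)" using J\<tau> by (intro conserved low) auto
    then show "(e has_real_derivative 0) (at x within {0..\<tau>})" using J\<tau> by (rule DERIV_subset)
  qed simp
  then have "e \<tau> = e 0" using \<tau> by auto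
  moreover have "c * \<rho>\<^sup>2 \<le> e \<tau>" using coercive[of \<tau>] low[of \<tau>] \<tau> J\<tau> by auto
  ultimately show False using init(2) by simp
qed

lemma continuous_on_state_dist:
  assumes "\<And>k. k \<in> I \<Longrightarrow> continuous_on J (\<lambda>t. fst (z t) k)" "\<And>k. k \<in> I \<Longrightarrow> continuous_on J (\<lambda>t. snd (z t) k)"
  shows "continuous_on J (\<lambda>t. state_dist I (z t) x)"
  unfolding state_dist_def by (intro continuous_intros assms)

text \<open>
  The confinement lemma is used twice: for arbitrary solutions, and for the solution of the truncated
  system, which it keeps in the region where truncated and true force agree.
\<close>

lemma polygon_equilibrium_stable:
  assumes n: "n = 2 * p + 1" and p: "p \<ge> 1"
  shows "lyapunov_stable {2..n} (reduced_phase_space n) (reduced_hamiltonian n) (polygon_equilibrium n)"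
proof -
  define X where "X = polygon_equilibrium n"
  let ?D = "\<lambda>z. state_dist {2..n} z X"
  let ?E = "\<lambda>z. reduced_hamiltonian n z - reduced_hamiltonian n X"
  let ?free = "\<lambda>z :: state. collision_free n (angles_of n (fst z))"
  obtain c C r s where pos: "c > 0" "C > 0" "r > 0" "s > 0" and near: "\<And>z. ?D z < r \<Longrightarrow>
    (\<forall>i\<in>{1..n}. \<forall>j\<in>{1..n}. i \<noteq> j \<longrightarrow> s \<le> \<bar>sin (angles_of n (fst z) i - angles_of n (fst z) j)\<bar>) \<and>
    c * (?D z)\<^sup>2 \<le> ?E z \<and> ?E z \<le> C * (?D z)\<^sup>2"
    using reduced_energy_bounds[OF n p] unfolding X_def by blast
  have free: "?free z" if "?D z < r" for z
    using near[OF that] pos(4) by (force simp: collision_free_iff_sin)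
  have equilibrium: "hamiltonian_equilibrium {2..n} (reduced_phase_space n) (reduced_hamiltonian n) X"
  proof -
    have "?D X = 0" by (simp add: state_dist_def)
    then have "?free X" using free pos by simp
    moreover have "generalized_force n (fst X) k = 0" for k
    proof -
      let ?q = "\<lambda>j. 2 * pi * real j / real n"
      have "torque n (angles_of n (fst X)) i = torque n ?q i" if "i \<in> {1..n}" for i
        unfolding torque_def X_def using that by (intro sum.cong refl) (simp add: angles_of_polygon)
      then show ?thesis using polygon_torque[of n 0] n by (simp add: generalized_force_def)
    qed
    ultimately show ?thesis
      unfolding hamiltonian_equilibrium_def reduced_solution_iff by (simp add: X_def polygon_equilibrium_def)
  qed
  have confined: "?D (z t) < \<rho>"
    if J: "J = {0..} \<or> J = {0..<T}" and \<rho>: "0 < \<rho>" "\<rho> < r" and start: "?D (z 0) < \<rho>" "C * (?D (z 0))\<^sup>2 < c * \<rho>\<^sup>2"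
      and cont: "\<And>k t. k \<in> {2..n} \<Longrightarrow> t \<in> J \<Longrightarrow> continuous (at t within J) (\<lambda>s. fst (z s) k)"
        "\<And>k t. k \<in> {2..n} \<Longrightarrow> t \<in> J \<Longrightarrow> continuous (at t within J) (\<lambda>s. snd (z s) k)"
      and sol: "\<And>k t. k \<in> {2..n} \<Longrightarrow> t \<in> J \<Longrightarrow> ?D (z t) < r \<Longrightarrow>
        ((\<lambda>s. fst (z s) k) has_real_derivative snd (z t) k / jacobi_mass k) (at t within J) \<and>
        ((\<lambda>s. snd (z s) k) has_real_derivative generalized_force n (fst (z t)) k) (at t within J)"
      and t: "t \<in> J" for J T z \<rho> t
  proof (rule energy_confinement[where d = "\<lambda>t. ?D (z t)" and e = "\<lambda>t. ?E (z t)" and c = c, OF J])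
    show "continuous_on J (\<lambda>t. ?D (z t))"
      using cont by (intro continuous_on_state_dist) (auto simp: continuous_on_eq_continuous_within)
    show "?D (z 0) < \<rho>" by (rule start)
    show "?E (z 0) < c * \<rho>\<^sup>2" using near[of "z 0"] start \<rho> by fastforce
    show "\<rho> < r" by (rule \<rho>)
    show "t \<in> J" by (rule t)
    fix t assume t: "t \<in> J" "?D (z t) < r"
    show "c * (?D (z t))\<^sup>2 \<le> ?E (z t)" using near[OF t(2)] by blast
    have "((\<lambda>s. reduced_hamiltonian n (z s)) has_real_derivative 0) (at t within J)"
      using sol[OF _ t] by (intro reduced_energy_conserved free t(2)) auto
    from DERIV_diff[OF this DERIV_const]
    show "((\<lambda>t. ?E (z t)) has_real_derivative 0) (at t within J)" by simp
  qed
  show ?thesis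
    unfolding lyapunov_stable_def X_def[symmetric]
  proof (intro conjI equilibrium allI impI)
    fix \<epsilon> :: real assume \<epsilon>: "\<epsilon> > 0"
    \<comment> \<open>The factor 1/2 keeps the sphere of radius \<rho> inside the region where the energy bounds hold.\<close>
    define \<rho> where "\<rho> = min \<epsilon> (r / 2)"
    have \<rho>: "0 < \<rho>" "\<rho> < r" "\<rho> \<le> \<epsilon>" using \<epsilon> pos by (auto simp: \<rho>_def)
    define \<delta> where "\<delta> = min \<rho> (\<rho> * sqrt (c / C))"
    have \<delta>: "\<delta> > 0" using \<rho> pos by (simp add: \<delta>_def)
    have start: "?D y < \<rho> \<and> C * (?D y)\<^sup>2 < c * \<rho>\<^sup>2" if "?D y < \<delta>" for y
    proof
      show "?D y < \<rho>" using that by (simp add: \<delta>_def)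
      have "?D y < \<rho> * sqrt (c / C)" using that by (simp add: \<delta>_def)
      then have "(?D y)\<^sup>2 < (\<rho> * sqrt (c / C))\<^sup>2" by (rule power_strict_mono) (auto simp: state_dist_nonneg)
      also have "\<dots> = \<rho>\<^sup>2 * (c / C)" using pos by (simp add: power_mult_distrib)
      finally show "C * (?D y)\<^sup>2 < c * \<rho>\<^sup>2" using pos by (simp add: field_simps)
    qed
    show "\<exists>\<delta>>0. \<forall>y\<in>reduced_phase_space n. ?D y < \<delta> \<longrightarrow>
        (\<exists>z. hamiltonian_solution {2..n} (reduced_phase_space n) (reduced_hamiltonian n) {0..} z \<and> z 0 = y) \<and>
        (\<forall>T z. hamiltonian_solution {2..n} (reduced_phase_space n) (reduced_hamiltonian n) {0..<T} z \<and> z 0 = y \<longrightarrow>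
             (\<forall>t\<in>{0..<T}. ?D (z t) < \<epsilon>))"
    proof (intro exI[of _ \<delta>] conjI \<delta> ballI impI allI)
      fix y assume y: "?D y < \<delta>"
      obtain u v where uv: "u 0 = fst y" "v 0 = snd y" and
        du: "\<And>t k. 0 \<le> t \<Longrightarrow> k \<in> {2..n} \<Longrightarrow> ((\<lambda>t. u t k) has_real_derivative v t k / jacobi_mass k) (at t within {0..})" and
        dv: "\<And>t k. 0 \<le> t \<Longrightarrow> k \<in> {2..n} \<Longrightarrow> ((\<lambda>t. v t k) has_real_derivative (\<Sum>i=1..n. angle_coeff i k *
          (\<Sum>j=1..n. truncated_force s (angles_of n (u t) i - angles_of n (u t) j)))) (at t within {0..})"
        using truncated_reduced_solution[OF pos(4), of "fst y" "snd y" n] by blast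
      define z where "z t = (u t, v t)" for t
      have true_force: "(\<Sum>i=1..n. angle_coeff i k * (\<Sum>j=1..n. truncated_force s (angles_of n (u t) i - angles_of n (u t) j)))
          = generalized_force n (u t) k" if "?D (z t) < r" for t k
        unfolding generalized_force_def torque_def
      proof (intro sum.cong refl arg_cong2[where f = "(*)"])
        fix i j assume ij: "i \<in> {1..n}" "j \<in> {1..n}"
        show "truncated_force s (angles_of n (u t) i - angles_of n (u t) j) = pair_force (angles_of n (u t) i - angles_of n (u t) j)"
        proof (cases "i = j")
          case True
          then show ?thesis by (simp add: truncated_force_def pair_force_def)
        next
          case False
          then show ?thesis using near[OF that] ij by (intro truncated_force_eq) (auto simp: z_def)
        qed
      qed
      have dv': "((\<lambda>t. v t k) has_real_derivative generalized_force n (u t) k) (at t within {0..})"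
        if "0 \<le> t" "k \<in> {2..n}" "?D (z t) < r" for t k
        using dv[OF that(1,2)] unfolding true_force[OF that(3)] .
      have z0: "z 0 = y" by (simp add: z_def uv)
      have start': "?D (z 0) < \<rho>" "C * (?D (z 0))\<^sup>2 < c * \<rho>\<^sup>2" unfolding z0 using start[OF y] by auto
      have cont: "continuous (at t within {0..}) (\<lambda>s. u s k)" "continuous (at t within {0..}) (\<lambda>s. v s k)"
        if "0 \<le> t" "k \<in> {2..n}" for t k
        using DERIV_continuous[OF du[OF that]] DERIV_continuous[OF dv[OF that]] by auto
      have close: "?D (z t) < \<rho>" if "t \<in> {0..}" for t
        by (rule confined[of "{0..}" _ \<rho> z t])
           (use \<rho> start' du dv' cont that in \<open>auto simp: z_def[abs_def]\<close>)
      have "hamiltonian_solution {2..n} (reduced_phase_space n) (reduced_hamiltonian n) {0..} z"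
        unfolding reduced_solution_iff
      proof (intro ballI conjI)
        fix t :: real assume t: "t \<in> {0..}"
        have Dr: "?D (z t) < r" using close[OF t] \<rho> by simp
        show "?free (z t)" by (rule free[OF Dr])
        fix k assume k: "k \<in> {2..n}"
        show "((\<lambda>s. fst (z s) k) has_real_derivative snd (z t) k / jacobi_mass k) (at t within {0..})"
          using du[OF _ k] t by (simp add: z_def)
        show "((\<lambda>s. snd (z s) k) has_real_derivative generalized_force n (fst (z t)) k) (at t within {0..})"
          using dv'[OF _ k Dr] t by (simp add: z_def)
      qed
      then show "\<exists>z. hamiltonian_solution {2..n} (reduced_phase_space n) (reduced_hamiltonian n) {0..} z \<and> z 0 = y"
        using z0 by blast
    next
      fix y T z t
      assume y: "?D y < \<delta>" and t: "t \<in> {0..<T}"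
        and z: "hamiltonian_solution {2..n} (reduced_phase_space n) (reduced_hamiltonian n) {0..<T} z \<and> z 0 = y"
      have sol: "((\<lambda>s. fst (z s) k) has_real_derivative snd (z t) k / jacobi_mass k) (at t within {0..<T})"
        "((\<lambda>s. snd (z s) k) has_real_derivative generalized_force n (fst (z t)) k) (at t within {0..<T})"
        if "t \<in> {0..<T}" "k \<in> {2..n}" for t k
        using z that unfolding reduced_solution_iff by blast+
      have cont: "continuous (at t within {0..<T}) (\<lambda>s. fst (z s) k)" "continuous (at t within {0..<T}) (\<lambda>s. snd (z s) k)"
        if "t \<in> {0..<T}" "k \<in> {2..n}" for t k
        using DERIV_continuous[OF sol(1)[OF that]] DERIV_continuous[OF sol(2)[OF that]] by auto
      have "?D (z t) < \<rho>"
        by (rule confined[of "{0..<T}" T \<rho> z t]) (use \<rho> start[OF y] z t sol cont in auto)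
      then show "?D (z t) < \<epsilon>" using \<rho> by simp
    qed
  qed
qed

lemma rotating_polygon_solution:
  assumes n: "n = 2 * p + 1"
  shows "hamiltonian_solution {1..n} (nbody_phase_space n) (nbody_hamiltonian n) UNIV (rotating_polygon n \<alpha>)"
  unfolding hamiltonian_solution_def
proof (intro ballI conjI)
  fix t :: real
  let ?\<phi> = "\<lambda>j. 2 * pi * real j / real n + \<alpha> * t"
  have free: "collision_free n ?\<phi>" by (rule polygon_collision_free[OF n])
  then show "rotating_polygon n \<alpha> t \<in> nbody_phase_space n"
    by (simp add: rotating_polygon_def nbody_phase_space_def)
  fix i assume i: "i \<in> {1..n}"
  have "((\<lambda>s. (\<Sum>k=1..n. (((\<lambda>_. \<alpha>)(i := s)) k)\<^sup>2 / 2) - potential n ?\<phi>) has_real_derivative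
      (\<Sum>k=1..n. if k = i then \<alpha> else 0) - 0) (at \<alpha>)"
  proof (intro DERIV_diff DERIV_const DERIV_sum)
    fix k
    show "((\<lambda>s. (((\<lambda>_. \<alpha>)(i := s)) k)\<^sup>2 / 2) has_real_derivative (if k = i then \<alpha> else 0)) (at \<alpha>)"
      by (cases "k = i") (auto intro!: derivative_eq_intros)
  qed
  then have "partial_mom (nbody_hamiltonian n) i (rotating_polygon n \<alpha> t) = \<alpha>"
    using i by (simp add: partial_mom_def nbody_hamiltonian_def rotating_polygon_def DERIV_imp_deriv)
  then show "((\<lambda>s. fst (rotating_polygon n \<alpha> s) i) has_real_derivative
      partial_mom (nbody_hamiltonian n) i (rotating_polygon n \<alpha> t)) (at t)"
    unfolding rotating_polygon_def by (auto intro!: derivative_eq_intros)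
  have upd: "?\<phi>(i := ?\<phi> i) = ?\<phi>" by (rule fun_upd_triv)
  have "((\<lambda>s. potential n (?\<phi>(i := s))) has_real_derivative
      (\<Sum>k=1..n. (if k = i then 1 else 0) * torque n (?\<phi>(i := ?\<phi> i)) k)) (at (?\<phi> i))"
    by (rule potential_has_derivative_along, unfold upd, rule free, rule has_derivative_coordinate)
  moreover have "torque n (?\<phi>(i := ?\<phi> i)) k = 0" for k
    unfolding upd using polygon_torque[of n "\<alpha> * t" k] n by simp
  ultimately have "((\<lambda>s. potential n (?\<phi>(i := s))) has_real_derivative 0) (at (?\<phi> i))" by simp
  from DERIV_diff[OF DERIV_const this]
  have "partial_pos (nbody_hamiltonian n) i (rotating_polygon n \<alpha> t) = 0"
    by (simp add: partial_pos_def nbody_hamiltonian_def rotating_polygon_def DERIV_imp_deriv)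
  then show "((\<lambda>s. snd (rotating_polygon n \<alpha> s) i) has_real_derivative
      - partial_pos (nbody_hamiltonian n) i (rotating_polygon n \<alpha> t)) (at t)"
    unfolding rotating_polygon_def by simp
qed

lemma rotating_polygon_reduces:
  assumes "n \<ge> 1"
  shows "reduces_to n (real n * \<alpha>) (rotating_polygon n \<alpha> t) (polygon_equilibrium n)"
  unfolding reduces_to_def
proof (intro conjI ballI)
  show "J1 n (rotating_polygon n \<alpha> t) = real n * \<alpha>" by (simp add: J1_def rotating_polygon_def)
  show "fst (polygon_equilibrium n) k = jacobi_u (fst (rotating_polygon n \<alpha> t)) k" if "k \<in> {2..n}" for k
    using jacobi_u_polygon[OF that, of "\<alpha> * t"] by (simp add: rotating_polygon_def polygon_equilibrium_def)
  show "snd (rotating_polygon n \<alpha> t) j = momenta_of n (snd (polygon_equilibrium n)) (real n * \<alpha>) j"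
    if "j \<in> {1..n}" for j
    using that assms
    by (simp add: rotating_polygon_def polygon_equilibrium_def momenta_of_def jacobi_g_def unit_coords_def)
qed

theorem theorem6:
  fixes n p :: nat and \<alpha> :: real
  assumes "p \<ge> 1" and "n = 2 * p + 1"
  shows "hamiltonian_solution {1..n} (nbody_phase_space n) (nbody_hamiltonian n) UNIV
           (rotating_polygon n \<alpha>) \<and>
         (\<forall>t. reduces_to n (real n * \<alpha>) (rotating_polygon n \<alpha> t) (polygon_equilibrium n)) \<and>
         lyapunov_stable {2..n} (reduced_phase_space n) (reduced_hamiltonian n)
           (polygon_equilibrium n)"
  using rotating_polygon_solution[OF assms(2)] rotating_polygon_reduces[of n]
    polygon_equilibrium_stable[OF assms(2,1)] assms(2) by simp

end
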